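(* For every $p\in(0,1)$ there exists $\alpha=\alpha(p)\in(1/2,1)$ such that $$\frac{\log \mathrm{LIS}(T_n)}{\log n}\xrightarrow[n\to\infty]{\mathbb P}\alpha,\qquad\text{and moreover}\qquad \alpha=\limsup_{n\to\infty}\frac{\log\mathbb E[\mathrm{LIS}(T_n)]}{\log n}.$$
   Context: A sign-decorated binary tree is a finite planar rooted tree in which every internal vertex (node) has exactly two ordered children and carries a sign $\oplus$ or $\ominus$; its size is its number of leaves. For a set $\mathcal L$ of leaves of $t$, the subtree $t|_{\mathcal L}$ is obtained by deleting all vertices with no descendant in $\mathcal L$ and contracting vertices with one child; signs are inherited. A subtree is positive if all its nodes carry $\oplus$. $\mathrm{LIS}(t)$ is the maximal number of leaves of a positive subtree of $t$. Fix $p\in(0,1)$. $T_n$ denotes a uniform planar rooted binary tree with $n$ leaves whose nodes carry i.i.d. signs with $\mathbb P(\oplus)=p$. *)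

theory Defs
  imports "HOL-Probability.Probability"
begin

text \<open>Sign-decorated binary trees: a leaf, or an internal node carrying a sign
  (True = plus, False = minus) with ordered left and right children.\<close>
datatype stree = SLeaf | SNode bool stree stree

datatype shape = Lf | Nd shape shape

fun nleaves :: "shape \<Rightarrow> nat" where
  "nleaves Lf = 1"
| "nleaves (Nd l r) = nleaves l + nleaves r"

fun leaves :: "stree \<Rightarrow> bool list set" where
  "leaves SLeaf = {[]}"
| "leaves (SNode s l r) = Cons False ` leaves l \<union> Cons True ` leaves r"

fun restrict :: "stree \<Rightarrow> bool list set \<Rightarrow> stree option" where
  "restrict SLeaf L = (if [] \<in> L then Some SLeaf else None)"
| "restrict (SNode s l r) L =
     (case (restrict l {xs. False # xs \<in> L}, restrict r {xs. True # xs \<in> L}) of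
        (None, None) \<Rightarrow> None
      | (Some a, None) \<Rightarrow> Some a
      | (None, Some b) \<Rightarrow> Some b
      | (Some a, Some b) \<Rightarrow> Some (SNode s a b))"

fun positive :: "stree \<Rightarrow> bool" where
  "positive SLeaf = True"
| "positive (SNode s l r) = (s \<and> positive l \<and> positive r)"

definition LIS :: "stree \<Rightarrow> nat" where
  "LIS t = Max {card L | L. L \<subseteq> leaves t \<and> L \<noteq> {} \<and>
                 (\<exists>u. restrict t L = Some u \<and> positive u)}"

fun decorate :: "real \<Rightarrow> shape \<Rightarrow> stree pmf" where
  "decorate p Lf = return_pmf SLeaf"
| "decorate p (Nd l r) =
     bind_pmf (bernoulli_pmf p) (\<lambda>s.
     bind_pmf (decorate p l) (\<lambda>a.
     bind_pmf (decorate p r) (\<lambda>b. return_pmf (SNode s a b))))"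

definition T :: "real \<Rightarrow> nat \<Rightarrow> stree pmf" where
  "T p n = bind_pmf (pmf_of_set {t. nleaves t = n}) (decorate p)"

end

theory Submission
  imports Defs "HOL-Real_Asymp.Real_Asymp"
begin

text \<open>Let \<open>G x\<close> be the probability that a critical binary Galton--Watson tree with random signs has
  \<open>LIS > x\<close>. The root decomposition gives \<open>2pG(x) + (1-p)G(x)\<^sup>2 = p P(X + X' > x)\<close> for independent copies
  \<open>X, X'\<close>, and the right-hand side is monotone in the values of \<open>G\<close> before \<open>x\<close>. Comparison with the
  Sibuya tails, whose convolution squares are explicit, shows \<open>G x = x\<^bsup>-\<beta>+o(1)\<^esup>\<close> for some
  \<open>\<beta> \<in> (1/2, 1)\<close>; the exponent of the theorem is \<open>\<alpha> = 1/(2\<beta>)\<close>, since a tree of size \<open>n\<close> or more has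
  probability of order \<open>n\<^bsup>-1/2\<^esup>\<close>.

  Conditioning on the size uses that \<open>LIS(T\<^sub>n)\<close> is stochastically increasing in \<open>n\<close> (Remy's leaf
  removal). This turns the upper bound on \<open>G\<close> into a tail bound for \<open>LIS(T\<^sub>n)\<close>, which a second moment
  recursion upgrades to \<open>E LIS(T\<^sub>n) \<le> n\<^bsup>\<alpha>+o(1)\<^esup>\<close>. Together with the lower bound on \<open>G\<close> it follows that
  \<open>LIS(T\<^sub>n) \<ge> n\<^bsup>\<alpha>-o(1)\<^esup>\<close> with probability at least \<open>n\<^bsup>-o(1)\<^esup>\<close>; as \<open>T\<^sub>n\<close> contains many disjoint large
  subtrees, this probability tends to one.\<close>

text \<open>\<beta> is not computed: it is the infimum of the parameters \<open>b\<close> for which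
  \<open>sibuya b\<close> is a subsolution. This determines the exponent because of a dichotomy: for
  \<open>b\<close> in (1/2, 1) the ratio of \<open>sibuya_excess b x\<close> to the square of
  \<open>sibuya b x\<close> never increases in \<open>x\<close>, so \<open>b\<close> either gives a
  subsolution at every \<open>x\<close> or a supersolution from some point on. The infimum is
  attained, so \<open>G\<close> is bounded below without loss in the exponent; each smaller
  \<open>b\<close> above 1/2 bounds it above up to a constant. The resulting tail bound at size
  \<open>n\<close> is of order n^(1/2) x^(-b) with b < 1, too heavy to be summed over
  \<open>x\<close> for the mean. Hence the detour through second moments: the mean is truncated at a
  multiple of n^(1/(2b)) and the rest is controlled by the second moment, which in turn is
  controlled by the means of smaller trees. The loop closes because a bound \<open>D\<close> on the
  means costs C0 D^2 in the second moment with \<open>C0\<close> independent of \<open>D\<close>, so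
  the truncation level can be fixed between \<open>C0\<close> and \<open>D\<close>.\<close>

section \<open>Catalan weights\<close>

text \<open>\<open>nu n\<close> is the probability \<open>2 Catalan(n-1) / 4\<^sup>n\<close> that a critical binary Galton--Watson tree has \<open>n\<close>
  leaves.\<close>

fun nu :: "nat \<Rightarrow> real" where
  "nu 0 = 0"
| "nu (Suc 0) = 1 / 2"
| "nu (Suc (Suc n)) = nu (Suc n) * (real n + 1 / 2) / (real n + 2)"

lemma nu_Suc:
  assumes "n \<ge> 1"
  shows "(real n + 1) * nu (Suc n) = (real n - 1 / 2) * nu n"
proof -
  obtain m where "n = Suc m" using assms by (cases n) auto
  then show ?thesis by (simp add: field_simps)
qed

lemma nu_pos: "n \<ge> 1 \<Longrightarrow> nu n > 0"
  by (induction n rule: nu.induct) auto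

lemma nu_nonneg: "nu n \<ge> 0"
  using nu_pos[of n] by (cases n) auto

lemma sum_antidiagonal_flip:
  fixes \<psi> :: "nat \<Rightarrow> nat \<Rightarrow> real"
  shows "(\<Sum>k=1..<n. \<psi> k (n - k)) = (\<Sum>k=1..<n. \<psi> (n - k) k)"
  by (rule sum.reindex_bij_witness[of _ "\<lambda>k. n - k" "\<lambda>k. n - k"]) auto

text \<open>By the symmetry k <-> n - k the weight k averages to n / 2.\<close>

lemma sum_antidiagonal_weighted:
  fixes \<psi> :: "nat \<Rightarrow> nat \<Rightarrow> real"
  assumes "\<And>i j. \<psi> i j = \<psi> j i"
  shows "2 * (\<Sum>k=1..<n. real k * \<psi> k (n - k)) = real n * (\<Sum>k=1..<n. \<psi> k (n - k))"
proof -
  have "(\<Sum>k=1..<n. real k * \<psi> k (n - k)) = (\<Sum>k=1..<n. real (n - k) * \<psi> (n - k) k)"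
    by (rule sum_antidiagonal_flip[of "\<lambda>i j. real i * \<psi> i j"])
  also have "\<dots> = (\<Sum>k=1..<n. (real n - real k) * \<psi> k (n - k))"
    by (intro sum.cong) (auto simp: of_nat_diff assms)
  also have "\<dots> = real n * (\<Sum>k=1..<n. \<psi> k (n - k)) - (\<Sum>k=1..<n. real k * \<psi> k (n - k))"
    by (simp add: left_diff_distrib sum_subtractf sum_distrib_left)
  finally show ?thesis by simp
qed

text \<open>Remy's leaf-removal identity for Catalan trees: weighting a split by the size of the left
  part and using the ratio of consecutive Catalan numbers lowers that part by one leaf.\<close>

lemma nu_convolution_shift:
  fixes \<phi> :: "nat \<Rightarrow> nat \<Rightarrow> real"
  assumes sym: "\<And>i j. \<phi> i j = \<phi> j i" and n: "n \<ge> 1"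
  shows "(real n + 1) * (\<Sum>k=1..<Suc n. nu k * nu (Suc n - k) * \<phi> k (Suc n - k))
    = nu n * \<phi> 1 n + (\<Sum>j=1..<n. (2 * real j - 1) * (nu j * nu (n - j) * \<phi> (Suc j) (n - j)))"
proof -
  have "(real n + 1) * (\<Sum>k=1..<Suc n. nu k * nu (Suc n - k) * \<phi> k (Suc n - k))
    = 2 * (\<Sum>k=1..<Suc n. real k * (nu k * nu (Suc n - k) * \<phi> k (Suc n - k)))"
    using sum_antidiagonal_weighted[of "\<lambda>i j. nu i * nu j * \<phi> i j" "Suc n"] sym
    by (simp add: mult.commute mult.left_commute add.commute)
  \<comment> \<open>A left part that is a single leaf cannot be lowered by one leaf, hence the
    separate boundary term.\<close>
  also have "(\<Sum>k=1..<Suc n. real k * (nu k * nu (Suc n - k) * \<phi> k (Suc n - k)))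
    = nu 1 * nu n * \<phi> 1 n + (\<Sum>k=2..<Suc n. real k * (nu k * nu (Suc n - k) * \<phi> k (Suc n - k)))"
    using n by (subst sum.atLeast_Suc_lessThan) (auto simp: numeral_2_eq_2)
  also have "(\<Sum>k=2..<Suc n. real k * (nu k * nu (Suc n - k) * \<phi> k (Suc n - k)))
    = (\<Sum>j=1..<n. real (Suc j) * (nu (Suc j) * nu (n - j) * \<phi> (Suc j) (n - j)))"
    using sum.shift_bounds_Suc_ivl[of "\<lambda>k. real k * (nu k * nu (Suc n - k) * \<phi> k (Suc n - k))" 1 n]
    by (simp add: numeral_2_eq_2)
  also have "\<dots> = (\<Sum>j=1..<n. (real j - 1 / 2) * (nu j * nu (n - j) * \<phi> (Suc j) (n - j)))"
  proof (intro sum.cong refl)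
    fix j assume "j \<in> {1..<n}"
    then have "real (Suc j) * nu (Suc j) = (real j - 1 / 2) * nu j"
      using nu_Suc[of j] by (simp add: add.commute)
    then show "real (Suc j) * (nu (Suc j) * nu (n - j) * \<phi> (Suc j) (n - j))
      = (real j - 1 / 2) * (nu j * nu (n - j) * \<phi> (Suc j) (n - j))"
      by (metis mult.assoc)
  qed
  finally show ?thesis
    by (simp add: distrib_left sum_distrib_left algebra_simps)
qed

text \<open>The weight 2 j - 1 is the number of vertices of a tree with \<open>j\<close> leaves,
  that is, of the places where Remy's growth can act inside the left part.\<close>

lemma sum_antidiagonal_odd:
  fixes \<psi> :: "nat \<Rightarrow> nat \<Rightarrow> real"
  assumes "\<And>i j. \<psi> i j = \<psi> j i"
  shows "(\<Sum>j=1..<n. (2 * real j - 1) * \<psi> j (n - j)) = (real n - 1) * (\<Sum>j=1..<n. \<psi> j (n - j))"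
  using sum_antidiagonal_weighted[of \<psi> n, OF assms]
  by (simp add: left_diff_distrib sum_subtractf mult.assoc flip: sum_distrib_left)

text \<open>The Catalan recurrence, as the constant case of the leaf-removal identity. It makes
  \<open>nu k * nu (n - k) / (2 * nu n)\<close> the law of the size of the left subtree in a uniform
  tree.\<close>

lemma nu_convolution:
  "n \<ge> 2 \<Longrightarrow> (\<Sum>k=1..<n. nu k * nu (n - k)) = 2 * nu n"
proof (induction n rule: less_induct)
  case (less n)
  then obtain m where m: "n = Suc m" "m \<ge> 1" by (cases n) auto
  have "(real m + 1) * (\<Sum>k=1..<n. nu k * nu (n - k))
    = nu m + (real m - 1) * (\<Sum>k=1..<m. nu k * nu (m - k))"
    using nu_convolution_shift[of "\<lambda>_ _. 1" m] sum_antidiagonal_odd[of "\<lambda>i j. nu i * nu j" m] m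
    by (simp add: mult.commute)
  also have "(real m - 1) * (\<Sum>k=1..<m. nu k * nu (m - k)) = (real m - 1) * (2 * nu m)"
    using less.IH[of m] m by (cases "m = 1") auto
  also have "nu m + (real m - 1) * (2 * nu m) = 2 * ((real m - 1 / 2) * nu m)"
    by (simp add: algebra_simps)
  also have "\<dots> = (real m + 1) * (2 * nu n)"
    using nu_Suc[of m] m by simp
  finally show ?case by simp
qed

lemma powr_three_halves: "x > 0 \<Longrightarrow> (x::real) powr (-(3/2)) = 1 / (x * sqrt x)"
proof -
  assume "x > 0"
  then have "x powr (3/2) = x * sqrt x"
    using powr_add[of x 1 "1/2"] by (simp add: powr_half_sqrt)
  then show ?thesis by (simp add: powr_minus_divide)
qed

text \<open>The product decreases in \<open>n\<close>, because (n - 1/2)^2 (n + 1) <= n^3.\<close>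

lemma nu_sqrt_upper: "n \<ge> 1 \<Longrightarrow> nu n * (real n * sqrt (real n)) \<le> 1 / 2"
proof (induction n rule: nat_induct_at_least)
  case base
  then show ?case by simp
next
  case (Suc n)
  have "nu (Suc n) * (real (Suc n) * sqrt (real (Suc n))) = (real n + 1) * nu (Suc n) * sqrt (real (Suc n))"
    by (simp add: algebra_simps)
  also have "\<dots> = nu n * ((real n - 1 / 2) * sqrt (real n + 1))"
    using nu_Suc[OF Suc.hyps] by (simp add: add.commute)
  also have "(real n - 1 / 2) * sqrt (real n + 1) \<le> real n * sqrt (real n)"
  proof -
    have "(real n - 1 / 2)\<^sup>2 * (real n + 1) \<le> (real n)\<^sup>2 * real n"
      using Suc.hyps by (simp add: power2_eq_square algebra_simps)
    then have "sqrt ((real n - 1 / 2)\<^sup>2 * (real n + 1)) \<le> sqrt ((real n)\<^sup>2 * real n)"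
      by (rule real_sqrt_le_mono)
    then show ?thesis using Suc.hyps by (simp add: real_sqrt_mult)
  qed
  finally show ?case using Suc.IH nu_pos[OF Suc.hyps] by (simp add: mult_left_mono)
qed

text \<open>With n - 1 under the root the product increases instead, starting from the value 1/4 at
  n = 2.\<close>

lemma nu_sqrt_lower: "n \<ge> 2 \<Longrightarrow> nu n * (real n * sqrt (real n - 1)) \<ge> 1 / 4"
proof (induction n rule: nat_induct_at_least)
  case base
  then show ?case by (simp add: numeral_2_eq_2)
next
  case (Suc n)
  have "nu (Suc n) * (real (Suc n) * sqrt (real (Suc n) - 1)) = (real n + 1) * nu (Suc n) * sqrt (real n)"
    by (simp add: algebra_simps)
  also have "\<dots> = nu n * ((real n - 1 / 2) * sqrt (real n))"
    using nu_Suc[of n] Suc.hyps by simp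
  finally have eq: "nu (Suc n) * (real (Suc n) * sqrt (real (Suc n) - 1))
    = nu n * ((real n - 1 / 2) * sqrt (real n))" .
  have "(real n)\<^sup>2 * (real n - 1) \<le> (real n - 1 / 2)\<^sup>2 * real n"
    using Suc.hyps by (simp add: power2_eq_square algebra_simps)
  then have "sqrt ((real n)\<^sup>2 * (real n - 1)) \<le> sqrt ((real n - 1 / 2)\<^sup>2 * real n)"
    by (rule real_sqrt_le_mono)
  then have "real n * sqrt (real n - 1) \<le> (real n - 1 / 2) * sqrt (real n)"
    using Suc.hyps by (simp add: real_sqrt_mult)
  then have "nu n * (real n * sqrt (real n - 1)) \<le> nu n * ((real n - 1 / 2) * sqrt (real n))"
    by (intro mult_left_mono nu_nonneg)
  then show ?case using Suc.IH eq by linarith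
qed

lemma nu_upper:
  assumes "n \<ge> 1"
  shows "nu n \<le> real n powr (-(3/2)) / 2"
  using nu_sqrt_upper[OF assms] assms
  by (simp add: powr_three_halves pos_le_divide_eq[of "real n * sqrt (real n)"] field_simps)

lemma nu_lower:
  assumes "n \<ge> 1"
  shows "nu n \<ge> real n powr (-(3/2)) / 4"
proof (cases "n = 1")
  case False
  then have n: "n \<ge> 2" using assms by simp
  have "1 / 4 \<le> nu n * (real n * sqrt (real n - 1))" by (rule nu_sqrt_lower[OF n])
  also have "\<dots> \<le> nu n * (real n * sqrt (real n))"
    by (intro mult_left_mono nu_nonneg) auto
  finally show ?thesis using n by (simp add: powr_three_halves field_simps)
qed simp

lemma powr_mult_half: "x > 0 \<Longrightarrow> x * (x::real) powr (-(3/2)) = x powr (-(1/2))"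
  using powr_add[of x 1 "-(3/2)"] by simp

lemma nu_tail_upper: "n \<ge> 1 \<Longrightarrow> 2 * real n * nu n \<le> real n powr (-(1/2))"
  using mult_left_mono[OF nu_upper[of n], of "2 * real n"] powr_mult_half[of "real n"]
  by (simp del: mult_le_cancel_left_pos)

lemma nu_tail_lower: "n \<ge> 1 \<Longrightarrow> 2 * real n * nu n \<ge> real n powr (-(1/2)) / 2"
  using mult_left_mono[OF nu_lower[of n], of "2 * real n"] powr_mult_half[of "real n"] by simp

text \<open>Telescoping: by \<open>nu_Suc\<close> the quantity \<open>2 * n * nu n\<close> drops by
  exactly \<open>nu n\<close> when \<open>n\<close> grows by one, and it tends to zero.\<close>

lemma nu_tail_sums:
  assumes "n \<ge> 1"
  shows "(\<lambda>k. nu (k + n)) sums (2 * real n * nu n)"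
proof -
  let ?f = "\<lambda>k. - (2 * real (k + n) * nu (k + n))"
  have "(\<lambda>k. real k powr (-(1/2))) \<longlonglongrightarrow> 0"
    by real_asymp
  then have "(\<lambda>k. 2 * real k * nu k) \<longlonglongrightarrow> 0"
    by (rule tendsto_sandwich[rotated 3, where f="\<lambda>_. 0"])
       (auto simp: nu_nonneg eventually_sequentially intro!: exI[of _ 1] nu_tail_upper)
  then have "(\<lambda>k. 2 * real (k + n) * nu (k + n)) \<longlonglongrightarrow> 0"
    by (rule LIMSEQ_ignore_initial_segment)
  then have "?f \<longlonglongrightarrow> 0" using tendsto_minus by fastforce
  then have "(\<lambda>k. ?f (Suc k) - ?f k) sums (0 - ?f 0)"
    by (rule telescope_sums)
  moreover have "?f (Suc k) - ?f k = nu (k + n)" for k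
    using nu_Suc[of "k + n"] assms by (simp add: algebra_simps)
  ultimately show ?thesis by simp
qed

lemma nu_sums: "nu sums 1"
  using nu_tail_sums[of 1] sums_Suc[of nu 1] by simp

section \<open>Power sums over splits\<close>

lemma sum_powr_le:
  fixes s :: real
  assumes "-1 < s" "s < 0"
  shows "(\<Sum>k=1..n. real k powr s) \<le> real n powr (s + 1) / (s + 1)"
proof (induction n)
  case (Suc n)
  have "(s + 1) * real (Suc n) powr s \<le> real (Suc n) powr (s + 1) - real n powr (s + 1)"
  proof (cases "n = 0")
    case True then show ?thesis using assms by simp
  next
    case False
    have "\<exists>z. real n < z \<and> z < real (Suc n) \<and>
      real (Suc n) powr (s + 1) - real n powr (s + 1) = (real (Suc n) - real n) * ((s + 1) * z powr s)"
      using False by (intro MVT2) (auto intro!: derivative_eq_intros)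
    then obtain z where z: "real n < z" "z < real (Suc n)"
      "real (Suc n) powr (s + 1) - real n powr (s + 1) = (s + 1) * z powr s" by auto
    have "real (Suc n) powr s \<le> z powr s"
      using z False assms by (intro powr_mono2') auto
    then show ?thesis using z assms by simp
  qed
  then have "real (Suc n) powr s \<le> real (Suc n) powr (s + 1) / (s + 1) - real n powr (s + 1) / (s + 1)"
    using assms by (simp add: pos_le_divide_eq mult.commute flip: diff_divide_distrib)
  then show ?case using Suc.IH by simp
qed simp

text \<open>The larger part is at least n / 2, so its negative power is at most that of n / 2, and
  the power of the smaller part is summed. Adding the powers of both parts keeps the bound
  symmetric.\<close>

lemma sum_split_powr_le:
  fixes s :: real
  assumes s: "-1 < s" "s < 0"
  shows "(\<Sum>k=1..<n. (real k * real (n - k)) powr s) \<le> 2 * (real n / 2) powr s * (real n powr (s + 1) / (s + 1))"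
proof -
  have pw: "(real k * real (n - k)) powr s \<le> (real n / 2) powr s * (real k powr s + real (n - k) powr s)"
    if "k \<in> {1..<n}" for k
  proof -
    have gen: "(a * b) powr s \<le> (real n / 2) powr s * (a powr s + b powr s)"
      if "0 < a" "0 < b" "a + b = real n" "a \<le> b" for a b :: real
    proof -
      have "b powr s \<le> (real n / 2) powr s" using that s by (intro powr_mono2') auto
      then have "a powr s * b powr s \<le> a powr s * (real n / 2) powr s" by (intro mult_left_mono) auto
      also have "\<dots> \<le> (real n / 2) powr s * (a powr s + b powr s)" by (simp add: algebra_simps)
      finally show ?thesis using that by (simp add: powr_mult)
    qed
    show ?thesis
      using gen[of "real k" "real (n - k)"] gen[of "real (n - k)" "real k"] that
      by (cases "k \<le> n - k") (auto simp: mult.commute add.commute)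
  qed
  have "(\<Sum>k=1..<n. (real k * real (n - k)) powr s)
    \<le> (\<Sum>k=1..<n. (real n / 2) powr s * (real k powr s + real (n - k) powr s))"
    by (rule sum_mono) (rule pw)
  also have "\<dots> = (real n / 2) powr s * ((\<Sum>k=1..<n. real k powr s) + (\<Sum>k=1..<n. real (n - k) powr s))"
    by (simp add: sum_distrib_left sum.distrib distrib_left)
  also have "(\<Sum>k=1..<n. real (n - k) powr s) = (\<Sum>k=1..<n. real k powr s)"
    using sum_antidiagonal_flip[of "\<lambda>i j. real j powr s" n] by simp
  also have "(\<Sum>k=1..<n. real k powr s) \<le> (\<Sum>k=1..n. real k powr s)"
    by (intro sum_mono2) auto
  also have "\<dots> \<le> real n powr (s + 1) / (s + 1)" by (rule sum_powr_le[OF s])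
  finally have "(\<Sum>k=1..<n. (real k * real (n - k)) powr s)
    \<le> (real n / 2) powr s * (real n powr (s + 1) / (s + 1) + real n powr (s + 1) / (s + 1))"
    by (simp add: mult_left_mono)
  then show ?thesis by (simp only: mult_2 [symmetric] mult_ac)
qed

lemma nu_mult_upper:
  assumes "k \<in> {1..<n}"
  shows "nu k * nu (n - k) \<le> (real k * real (n - k)) powr (-(3/2)) / 4"
proof -
  have "nu k * nu (n - k) \<le> (real k powr (-(3/2)) / 2) * (real (n - k) powr (-(3/2)) / 2)"
    using assms by (intro mult_mono nu_upper nu_nonneg) auto
  then show ?thesis by (simp add: powr_mult)
qed

lemma nu_mult_lower:
  assumes "k \<in> {1..<n}"
  shows "nu k * nu (n - k) \<ge> (real k * real (n - k)) powr (-(3/2)) / 16"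
proof -
  have "(real k powr (-(3/2)) / 4) * (real (n - k) powr (-(3/2)) / 4) \<le> nu k * nu (n - k)"
    using assms by (intro mult_mono nu_lower nu_nonneg) auto
  then show ?thesis by (simp add: powr_mult)
qed

text \<open>The range of \<open>a\<close> puts a - 3/2 strictly between -1 and 0, so neither end of
  the sum dominates and its order is that of \<open>n\<close> terms of order n^(2a-3).\<close>

lemma sum_nu_split_upper:
  assumes a: "1/2 < a" "a < 3/2"
  shows "(\<Sum>k=1..<n. nu k * nu (n - k) * (real k * real (n - k)) powr a)
    \<le> 2 powr (1/2 - a) / (a - 1/2) * real n powr (2 * a - 2)"
proof (cases "n = 0")
  case False
  have "(\<Sum>k=1..<n. nu k * nu (n - k) * (real k * real (n - k)) powr a)
    \<le> (\<Sum>k=1..<n. 1/4 * (real k * real (n - k)) powr (a - 3/2))"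
  proof (rule sum_mono)
    fix k assume k: "k \<in> {1..<n}"
    have "nu k * nu (n - k) * (real k * real (n - k)) powr a
      \<le> (real k * real (n - k)) powr (-(3/2)) / 4 * (real k * real (n - k)) powr a"
      by (intro mult_right_mono nu_mult_upper[OF k]) auto
    also have "\<dots> = 1/4 * (real k * real (n - k)) powr (a - 3/2)"
      by (simp flip: powr_add)
    finally show "nu k * nu (n - k) * (real k * real (n - k)) powr a
      \<le> 1/4 * (real k * real (n - k)) powr (a - 3/2)" .
  qed
  also have "\<dots> \<le> 1/4 * (2 * (real n / 2) powr (a - 3/2) * (real n powr (a - 3/2 + 1) / (a - 3/2 + 1)))"
    unfolding sum_distrib_left[symmetric] using a by (intro mult_left_mono sum_split_powr_le) auto
  also have "\<dots> = (1/2 * 2 powr (3/2 - a)) / (a - 1/2) * (real n powr (a - 3/2) * real n powr (a - 1/2))"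
  proof -
    have "(real n / 2) powr (a - 3/2) = real n powr (a - 3/2) * 2 powr (3/2 - a)"
      using powr_minus_divide[of 2 "a - 3/2"] by (simp add: powr_divide)
    then show ?thesis by simp
  qed
  also have "1/2 * 2 powr (3/2 - a) = 2 powr (1/2 - (a::real))"
    using powr_add[of 2 "-1" "3/2 - a"] by (simp add: powr_minus)
  also have "real n powr (a - 3/2) * real n powr (a - 1/2) = real n powr (2 * a - 2)"
    by (simp flip: powr_add)
  finally show ?thesis .
qed simp

text \<open>The order n^(-2) matches \<open>sum_nu_split_upper\<close> at a = 1. Each term is
  smallest when k (n - k) is largest, where it is at most (n / 2)^2.\<close>

lemma sum_nu_split_lower:
  assumes n: "n \<ge> 2"
  shows "(\<Sum>k=1..<n. nu k * nu (n - k) * (real k * real (n - k) / (real n)\<^sup>2)) \<ge> 1 / 16 * real n powr (-2)"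
proof -
  have "1 / 16 * (2 / real n) / (real n)\<^sup>2 \<le> nu k * nu (n - k) * (real k * real (n - k) / (real n)\<^sup>2)"
    if k: "k \<in> {1..<n}" for k
  proof -
    define y where "y = real k * real (n - k)"
    have y: "y > 0" using k by (auto simp: y_def)
    have "y \<le> (real n / 2)\<^sup>2"
    proof -
      have "real (n - k) = real n - real k" using k by auto
      moreover have "0 \<le> (real n / 2 - real k)\<^sup>2" by simp
      ultimately show ?thesis by (simp add: y_def power2_eq_square field_simps)
    qed
    then have "sqrt y \<le> real n / 2" by (intro real_le_lsqrt) auto
    then have "1 / (real n / 2) \<le> 1 / sqrt y"
      using y by (intro frac_le) auto
    also have "1 / sqrt y = y powr (-(3/2)) * y"
      using y by (simp add: powr_three_halves)
    finally have "1 / 16 * (2 / real n) \<le> y powr (-(3/2)) / 16 * y" by simp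
    also have "\<dots> \<le> nu k * nu (n - k) * y"
      using y nu_mult_lower[OF k] by (intro mult_right_mono) (auto simp: y_def)
    finally have "1 / 16 * (2 / real n) / (real n)\<^sup>2 \<le> nu k * nu (n - k) * y / (real n)\<^sup>2"
      by (rule divide_right_mono) simp
    then show ?thesis by (simp add: y_def)
  qed
  then have "(\<Sum>k=1..<n. 1 / 16 * (2 / real n) / (real n)\<^sup>2)
    \<le> (\<Sum>k=1..<n. nu k * nu (n - k) * (real k * real (n - k) / (real n)\<^sup>2))"
    by (rule sum_mono)
  moreover have "1 / 16 * real n powr (-2) \<le> (\<Sum>k=1..<n. 1 / 16 * (2 / real n) / (real n)\<^sup>2)"
  proof -
    have "real n powr (-2) = 1 / (real n)\<^sup>2"
      using n by (simp add: powr_minus_divide powr_numeral)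
    moreover have "1 \<le> (real n - 1) * (2 / real n)" using n by (simp add: field_simps)
    ultimately show ?thesis using n by (simp add: of_nat_diff field_simps)
  qed
  ultimately show ?thesis by linarith
qed

section \<open>Tails of sums of independent variables\<close>

text \<open>If \<open>A\<close> and \<open>B\<close> are the tail functions \<open>x \<mapsto> P(X > x)\<close> of independent positive integer
  variables, then \<open>sum_tail A B x\<close> is the probability that their sum exceeds \<open>x\<close>.\<close>

definition sum_tail :: "(nat \<Rightarrow> real) \<Rightarrow> (nat \<Rightarrow> real) \<Rightarrow> nat \<Rightarrow> real" where
  "sum_tail A B x = (\<Sum>i<x. A i * B (x - 1 - i)) - (\<Sum>i=1..<x. A i * B (x - i))"

lemma sum_tail_commute: "sum_tail A B x = sum_tail B A x"
proof -
  have "(\<Sum>i<x. A i * B (x - 1 - i)) = (\<Sum>i<x. B i * A (x - 1 - i))"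
    by (rule sum.reindex_bij_witness[of _ "\<lambda>k. x - 1 - k" "\<lambda>k. x - 1 - k"]) auto
  moreover have "(\<Sum>i=1..<x. A i * B (x - i)) = (\<Sum>i=1..<x. B i * A (x - i))"
    using sum_antidiagonal_flip[of "\<lambda>i j. A i * B j" x] by (simp add: mult.commute)
  ultimately show ?thesis by (simp add: sum_tail_def)
qed

text \<open>Conditioning on the value \<open>i\<close> of the first variable, which has probability
  \<open>A (i - 1) - A i\<close>. In this form monotonicity in \<open>B\<close> is visible, and no
  value at \<open>x\<close> occurs.\<close>

lemma sum_tail_by_parts:
  assumes "x \<ge> 1"
  shows "sum_tail A B x = A (x - 1) * B 0 + (\<Sum>i=1..<x. (A (i - 1) - A i) * B (x - i))"
proof -
  obtain y where y: "x = Suc y" using assms by (cases x) auto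
  have "(\<Sum>i<x. A i * B (x - 1 - i)) = (\<Sum>i<y. A i * B (y - i)) + A y * B 0"
    by (simp add: y)
  also have "(\<Sum>i<y. A i * B (y - i)) = (\<Sum>i=1..<x. A (i - 1) * B (x - i))"
    unfolding y One_nat_def sum.shift_bounds_Suc_ivl by (simp add: lessThan_atLeast0)
  finally show ?thesis
    by (simp add: sum_tail_def y left_diff_distrib sum_subtractf)
qed

lemma sum_tail_mono_right:
  assumes "x \<ge> 1" "antimono A" "\<And>y. 0 \<le> A y" "\<And>y. y < x \<Longrightarrow> B y \<le> B' y"
  shows "sum_tail A B x \<le> sum_tail A B' x"
proof -
  have "A i \<le> A (i - 1)" for i using assms(2) by (simp add: antimonoD)
  then show ?thesis
    unfolding sum_tail_by_parts[OF assms(1)] using assms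
    by (intro add_mono mult_left_mono sum_mono) auto
qed

text \<open>One argument is changed at a time, passing through the mixed tail of \<open>A\<close>
  and \<open>B'\<close>; this is why the tail hypotheses concern these two functions.\<close>

lemma sum_tail_mono:
  assumes "x \<ge> 1" "antimono A" "\<And>y. 0 \<le> A y" "antimono B'" "\<And>y. 0 \<le> B' y"
    and "\<And>y. y < x \<Longrightarrow> A y \<le> A' y" "\<And>y. y < x \<Longrightarrow> B y \<le> B' y"
  shows "sum_tail A B x \<le> sum_tail A' B' x"
proof -
  have "sum_tail A B x \<le> sum_tail A B' x"
    by (rule sum_tail_mono_right) (use assms in auto)
  also have "\<dots> = sum_tail B' A x" by (rule sum_tail_commute)
  also have "\<dots> \<le> sum_tail B' A' x"
    by (rule sum_tail_mono_right) (use assms in auto)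
  also have "\<dots> = sum_tail A' B' x" by (rule sum_tail_commute)
  finally show ?thesis .
qed

text \<open>The right-hand side is the tail of the maximum, which a sum of nonnegative variables
  dominates.\<close>

lemma sum_tail_ge_max:
  assumes "x \<ge> 1" "antimono A" "antimono B" "A 0 = 1" "B 0 = 1" "\<And>y. B y \<le> 1"
  shows "sum_tail A B x \<ge> A x + B x - A x * B x"
proof -
  have dec: "A i \<le> A (i - 1)" for i using assms(2) by (simp add: antimonoD)
  obtain y where y: "x = Suc y" using assms(1) by (cases x) auto
  have tel: "(\<Sum>i=1..<Suc y. A (i - 1) - A i) = 1 - A y" for y
    by (induction y) (auto simp: assms(4))
  have "(A 0 - A y) * B x = (\<Sum>i=1..<x. (A (i - 1) - A i) * B x)"
    unfolding sum_distrib_right[symmetric] y tel by (simp add: assms(4))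
  also have "\<dots> \<le> (\<Sum>i=1..<x. (A (i - 1) - A i) * B (x - i))"
    using dec assms(3) by (intro sum_mono mult_left_mono) (auto simp: antimonoD)
  finally have "sum_tail A B x \<ge> A y + (1 - A y) * B x"
    unfolding sum_tail_by_parts[OF assms(1)] by (simp add: y assms)
  moreover have "A x * (1 - B x) \<le> A y * (1 - B x)"
    using assms(2) assms(6) by (intro mult_right_mono) (auto simp: y antimonoD)
  ultimately show ?thesis by (simp add: algebra_simps)
qed

text \<open>For tails with value 1 at 0 this is P(X + X' > x) - P(X > x) - P(X' > x), and the tail
  equation becomes (1-p) G(x)^2 = p \<open>excess G G x\<close>. Being a difference of two
  consecutive full convolutions, it can be read off from generating functions.\<close>

definition excess :: "(nat \<Rightarrow> real) \<Rightarrow> (nat \<Rightarrow> real) \<Rightarrow> nat \<Rightarrow> real" where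
  "excess A B x = (\<Sum>i<x. A i * B (x - 1 - i)) - (\<Sum>i\<le>x. A i * B (x - i))"

lemma sum_tail_eq_excess:
  assumes "x \<ge> 1" "A 0 = 1"
  shows "sum_tail A A x = 2 * A x + excess A A x"
proof -
  obtain y where y: "x = Suc y" using assms(1) by (cases x) auto
  have "(\<Sum>i\<le>x. A i * A (x - i)) = A 0 * A x + (\<Sum>i=1..<x. A i * A (x - i)) + A x * A 0"
    unfolding y by (simp add: atMost_atLeast0 atLeast0_atMost_Suc_eq_insert_0
      sum.atLeast0_atMost_Suc sum.atLeast_Suc_atMost atLeastLessThanSuc_atLeastAtMost)
  then show ?thesis by (simp add: sum_tail_def excess_def assms(2))
qed

lemma excess_commute: "excess A B x = excess B A x"
proof -
  have "(\<Sum>i<x. A i * B (x - 1 - i)) = (\<Sum>i<x. B i * A (x - 1 - i))"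
    by (rule sum.reindex_bij_witness[of _ "\<lambda>k. x - 1 - k" "\<lambda>k. x - 1 - k"]) auto
  moreover have "(\<Sum>i\<le>x. A i * B (x - i)) = (\<Sum>i\<le>x. B i * A (x - i))"
    by (rule sum.reindex_bij_witness[of _ "\<lambda>k. x - k" "\<lambda>k. x - k"]) auto
  ultimately show ?thesis by (simp add: excess_def)
qed

lemma excess_by_parts:
  "excess A B x = (\<Sum>i<x. (A i - A (Suc i)) * B (x - 1 - i)) - A 0 * B x"
proof -
  have "(\<Sum>i\<le>x. A i * B (x - i)) = A 0 * B x + (\<Sum>i<x. A (Suc i) * B (x - 1 - i))"
    using sum.atMost_shift[of "\<lambda>i. A i * B (x - i)" x] by simp
  then show ?thesis by (simp add: excess_def left_diff_distrib sum_subtractf)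
qed

lemma excess_mono_right:
  assumes "antimono A" "\<And>y. B y \<le> B' y" "B x = B' x"
  shows "excess A B x \<le> excess A B' x"
proof -
  have "A (Suc i) \<le> A i" for i using assms(1) by (simp add: antimonoD)
  then show ?thesis
    unfolding excess_by_parts assms(3) using assms(2)
    by (intro diff_right_mono sum_mono mult_left_mono) auto
qed

text \<open>Agreement at \<open>x\<close> freezes the negative term of
  \<open>excess_by_parts\<close>. No value at 0 is prescribed, so \<open>B\<close> may be a multiple
  of a Sibuya tail.\<close>

lemma excess_mono:
  assumes "antimono A" "antimono B" "\<And>y. A y \<le> B y" "A x = B x"
  shows "excess A A x \<le> excess B B x"
proof -
  have "excess A A x \<le> excess A B x" by (rule excess_mono_right) (use assms in auto)
  also have "\<dots> = excess B A x" by (rule excess_commute)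
  also have "\<dots> \<le> excess B B x" by (rule excess_mono_right) (use assms in auto)
  finally show ?thesis .
qed

section \<open>Sibuya tails\<close>

text \<open>The generating function of \<open>sibuya b\<close> is \<open>(1 - z)\<^bsup>b-1\<^esup>\<close>, so its convolution square is
  explicit; \<open>sibuya b x\<close> is of order \<open>x\<^bsup>-b\<^esup>\<close>.\<close>

definition sibuya :: "real \<Rightarrow> nat \<Rightarrow> real" where
  "sibuya b x = pochhammer (1 - b) x / fact x"

text \<open>For x >= 1 this is the coefficient of z^x in -(1 - z)^(2b-1): taking differences
  multiplies the convolution square (1 - z)^(2b-2) by z - 1.\<close>

definition sibuya_excess :: "real \<Rightarrow> nat \<Rightarrow> real" where
  "sibuya_excess b x = (2 * b - 1) * pochhammer (2 - 2 * b) (x - 1) / fact x"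

lemma sibuya_0 [simp]: "sibuya b 0 = 1"
  by (simp add: sibuya_def)

lemma sibuya_Suc: "sibuya b (Suc x) = sibuya b x * ((real x + 1 - b) / (real x + 1))"
  by (simp add: sibuya_def pochhammer_rec' field_simps)

lemma sibuya_excess_Suc:
  assumes "x \<ge> 1"
  shows "sibuya_excess b (Suc x) = sibuya_excess b x * ((real x + 1 - 2 * b) / (real x + 1))"
proof -
  obtain y where "x = Suc y" using assms by (cases x) auto
  then show ?thesis
    by (simp add: sibuya_excess_def pochhammer_rec'[of _ y] field_simps)
qed

lemma sibuya_pos: "b < 1 \<Longrightarrow> sibuya b x > 0"
  by (simp add: sibuya_def pochhammer_pos)

lemma sibuya_antimono:
  assumes "0 \<le> b" "b < 1"
  shows "antimono (sibuya b)"
proof (rule decseq_SucI)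
  fix x
  have "sibuya b x * ((real x + 1 - b) / (real x + 1)) \<le> sibuya b x * 1"
    using assms sibuya_pos[of b x] by (intro mult_left_mono) auto
  then show "sibuya b (Suc x) \<le> sibuya b x" by (simp add: sibuya_Suc)
qed

lemma excess_sibuya:
  assumes "x \<ge> 1"
  shows "excess (sibuya b) (sibuya b) x = sibuya_excess b x"
proof -
  \<comment> \<open>Vandermonde's identity for rising factorials, that is, the square of the
    generating function.\<close>
  have conv: "(\<Sum>i\<le>m. sibuya b i * sibuya b (m - i)) = pochhammer (2 - 2 * b) m / fact m" for m
  proof -
    have "pochhammer (2 - 2 * b) m = (\<Sum>i\<le>m. of_nat (m choose i) * pochhammer (1 - b) i * pochhammer (1 - b) (m - i))"
      using pochhammer_binomial_sum[of "1 - b" "1 - b" m] by simp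
    also have "\<dots> = (\<Sum>i\<le>m. fact m * (sibuya b i * sibuya b (m - i)))"
      by (intro sum.cong) (auto simp: sibuya_def binomial_fact field_simps)
    finally show ?thesis by (simp flip: sum_distrib_left)
  qed
  obtain y where y: "x = Suc y" using assms by (cases x) auto
  have "excess (sibuya b) (sibuya b) x = pochhammer (2 - 2 * b) y / fact y - pochhammer (2 - 2 * b) x / fact x"
    using conv[of y] conv[of x] by (simp add: excess_def y lessThan_Suc_atMost)
  moreover have "pochhammer (2 - 2 * b) y / fact y = (real y + 1) * pochhammer (2 - 2 * b) y / fact x"
    by (simp add: y add.commute)
  ultimately show ?thesis
    by (simp add: sibuya_excess_def y pochhammer_rec' left_diff_distrib flip: diff_divide_distrib)
       (simp add: algebra_simps)
qed

text \<open>Consecutive values have ratio 1 - b u with u = 1 / (x + 1), at most (1 + u)^(-b). The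
  shift to \<open>Suc x\<close> makes the bound exact at 0.\<close>

lemma sibuya_upper:
  assumes "0 \<le> b" "b < 1"
  shows "sibuya b x \<le> real (Suc x) powr (-b)"
proof (induction x)
  case (Suc x)
  have "(real x + 1 - b) / (real x + 1) = 1 + (-b) * (1 / (real x + 1))"
    by (simp add: field_simps)
  also have "\<dots> \<le> (1 + 1 / (real x + 1)) powr (-b)"
  proof -
    let ?u = "1 / (real x + 1)"
    have "1 + (-b) * ?u \<le> exp (-b * ln (1 + ?u))"
    proof -
      have "ln (1 + ?u) \<le> ?u" by (rule ln_add_one_self_le_self) simp
      then have "1 + (-b) * ?u \<le> 1 + (-b) * ln (1 + ?u)"
        using assms mult_left_mono[of _ _ b] by fastforce
      also have "\<dots> \<le> exp (-b * ln (1 + ?u))" by (rule exp_ge_add_one_self)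
      finally show ?thesis .
    qed
    moreover have "1 + ?u > 0" by (simp add: add_pos_nonneg)
    ultimately show ?thesis by (simp add: powr_def)
  qed
  finally have "(real x + 1 - b) / (real x + 1) \<le> (1 + 1 / (real x + 1)) powr (-b)" .
  then have "sibuya b (Suc x) \<le> real (Suc x) powr (-b) * (1 + 1 / (real x + 1)) powr (-b)"
    unfolding sibuya_Suc using Suc assms by (intro mult_mono) auto
  also have "\<dots> = (real (Suc x) * (1 + 1 / (real x + 1))) powr (-b)"
    by (rule powr_mult[symmetric])
  also have "real (Suc x) * (1 + 1 / (real x + 1)) = real (Suc (Suc x))"
    by (simp add: field_simps)
  finally show ?case .
qed simp

lemma powr_Bernoulli_concave:
  fixes u b :: real
  assumes "0 \<le> b" "b \<le> 1" "0 \<le> u"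
  shows "u powr b \<le> 1 - b * (1 - u)"
proof (cases "u = 0")
  case False
  have "exp ((1 - b) * 0 + b * ln u) \<le> (1 - b) * exp 0 + b * exp (ln u)"
    using convex_onD[OF exp_convex, of b 0 "ln u"] assms by simp
  then show ?thesis using False assms by (simp add: powr_def algebra_simps)
qed (use assms in auto)

lemma sibuya_lower:
  assumes "0 \<le> b" "b < 1" "x \<ge> 1"
  shows "sibuya b x \<ge> (1 - b) * real x powr (-b)"
  using assms(3)
proof (induction x rule: nat_induct_at_least)
  case base
  then show ?case by (simp add: sibuya_Suc)
next
  case (Suc x)
  let ?u = "real x / (real x + 1)"
  have "?u powr b \<le> 1 - b * (1 - ?u)"
    using assms by (intro powr_Bernoulli_concave) auto
  also have "\<dots> = (real x + 1 - b) / (real x + 1)"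
    by (simp add: field_simps)
  finally have "(1 - b) * real x powr (-b) * ?u powr b \<le> sibuya b x * ((real x + 1 - b) / (real x + 1))"
    using Suc.IH assms sibuya_pos[of b x] by (intro mult_mono) auto
  moreover have "real x powr (-b) * ?u powr b = real (Suc x) powr (-b)"
    using Suc.hyps by (simp add: powr_divide powr_minus field_simps)
  ultimately show ?case by (simp add: sibuya_Suc mult.assoc)
qed

section \<open>The tail exponent\<close>

text \<open>The inequality says that \<open>sibuya b\<close> is a subsolution of the tail equation,
  after cancellation of the terms linear in the tail.\<close>

definition sub_exponents :: "real \<Rightarrow> real set" where
  "sub_exponents p = {b. 1/2 < b \<and> b < 1 \<and> (\<forall>x\<ge>1. (1 - p) * (sibuya b x)\<^sup>2 \<le> p * sibuya_excess b x)}"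

definition tail_exponent :: "real \<Rightarrow> real" where
  "tail_exponent p = Inf (sub_exponents p)"

text \<open>The middle factor is the ratio of \<open>sibuya_excess b\<close> to the square of
  \<open>sibuya b\<close> at x = 2. The last factor falls from 1 towards 1/2, so later ratios keep
  at least half of this value.\<close>

lemma sibuya_excess_lower:
  assumes b: "1/2 < b" "b < 1" and x: "x \<ge> 2"
  shows "sibuya_excess b x \<ge>
    (sibuya b x)\<^sup>2 * (4 * (2 * b - 1) / ((1 - b) * (2 - b)\<^sup>2)) * (real x / (2 * (real x - 1)))"
  using x
proof (induction x rule: nat_induct_at_least)
  case base
  have alg: "(u * v / 2)\<^sup>2 * (4 * w / (u * v\<^sup>2)) = u * w" if "u \<noteq> 0" "v \<noteq> 0" for u v w :: real
    using that by (simp add: power2_eq_square)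
  have "sibuya b 2 = (1 - b) * (2 - b) / 2"
    by (simp add: sibuya_def numeral_2_eq_2 pochhammer_rec')
  moreover have "sibuya_excess b 2 = (1 - b) * (2 * b - 1)"
    by (simp add: sibuya_excess_def numeral_2_eq_2 field_simps)
  ultimately show ?case
    using alg[of "1 - b" "2 - b" "2 * b - 1"] b by (simp only:) simp
next
  case (Suc x)
  define R where "R = 4 * (2 * b - 1) / ((1 - b) * (2 - b)\<^sup>2)"
  define c where "c = real x + 1"
  have R: "R \<ge> 0" using b by (simp add: R_def)
  have c: "c \<ge> 3" using Suc.hyps by (simp add: c_def)
  \<comment> \<open>Writing c (c - 2b) = (c - b)^2 - b^2 and c (c - 2) = (c - 1)^2 - 1 reduces the
    one-step comparison to b (c - 1) <= c - b.\<close>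
  have key: "(c - b)\<^sup>2 / c\<^sup>2 * (c / (2 * (c - 1))) \<le> (c - 1) / (2 * (c - 2)) * ((c - 2 * b) / c)"
  proof -
    have "(c - b)\<^sup>2 * (c * (c - 2)) \<le> (c - 1)\<^sup>2 * (c * (c - 2 * b))"
    proof -
      have "((c - b)\<^sup>2 - b\<^sup>2) * (c - 1)\<^sup>2 - (c - b)\<^sup>2 * ((c - 1)\<^sup>2 - 1) = (c - b)\<^sup>2 - (b * (c - 1))\<^sup>2"
        by (simp add: power2_eq_square algebra_simps)
      moreover have "b * (c - 1) \<le> c - b"
      proof -
        have "b * c \<le> 1 * c" using b c by (intro mult_right_mono) auto
        then show ?thesis by (simp add: algebra_simps)
      qed
      then have "(b * (c - 1))\<^sup>2 \<le> (c - b)\<^sup>2" using b c by (intro power_mono) auto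
      moreover have "(c - b)\<^sup>2 - b\<^sup>2 = c * (c - 2 * b)" "(c - 1)\<^sup>2 - 1 = c * (c - 2)"
        by (simp_all add: power2_eq_square algebra_simps)
      ultimately show ?thesis by (simp add: mult.commute)
    qed
    then have "(c - b)\<^sup>2 * (c - 2) \<le> (c - 1)\<^sup>2 * (c - 2 * b)"
      using c by (simp add: mult.left_commute)
    then show ?thesis
      using c by (simp add: divide_simps power2_eq_square) (simp add: algebra_simps)
  qed
  have "(sibuya b (Suc x))\<^sup>2 * R * (real (Suc x) / (2 * (real (Suc x) - 1)))
    = (sibuya b x)\<^sup>2 * R * ((c - b)\<^sup>2 / c\<^sup>2 * (c / (2 * (c - 1))))"
    by (simp add: sibuya_Suc c_def power_mult_distrib power_divide add.commute)
  also have "\<dots> \<le> (sibuya b x)\<^sup>2 * R * ((c - 1) / (2 * (c - 2)) * ((c - 2 * b) / c))"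
    using R by (intro mult_left_mono key) auto
  also have "\<dots> = (sibuya b x)\<^sup>2 * R * (real x / (2 * (real x - 1))) * ((c - 2 * b) / c)"
    by (simp add: c_def)
  also have "\<dots> \<le> sibuya_excess b x * ((c - 2 * b) / c)"
    using Suc.IH b c unfolding R_def by (intro mult_right_mono) auto
  also have "\<dots> = sibuya_excess b (Suc x)"
    using Suc.hyps by (simp add: sibuya_excess_Suc c_def)
  finally show ?case unfolding R_def .
qed

text \<open>As \<open>b\<close> tends to 1 the ratio at x = 2 grows like 1 / (1 - b). At distance p
  / 4 from 1 it is at least 4 / p, which suffices even after halving; x = 1 is checked by
  hand.\<close>

lemma sub_exponents_nonempty:
  assumes p: "0 < p" "p < 1"
  shows "1 - p / 4 \<in> sub_exponents p"
proof -
  define b where "b = 1 - p / 4"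
  have b: "3/4 < b" "b < 1" using p by (auto simp: b_def)
  have "(1 - p) * (sibuya b x)\<^sup>2 \<le> p * sibuya_excess b x" if x: "x \<ge> 1" for x
  proof (cases "x = 1")
    case True
    have "p * (1 - p) * (p * (1/16)) \<le> 1 * (p * (1/2))"
      using p by (intro mult_mono) (auto simp: mult_le_one)
    moreover have "p * (1/2) \<le> p * (2 * b - 1)" using p b by (intro mult_left_mono) auto
    moreover have "(1 - p) * (p / 4)\<^sup>2 = p * (1 - p) * (p * (1/16))"
      by (simp add: power2_eq_square)
    ultimately have "(1 - p) * (p / 4)\<^sup>2 \<le> p * (2 * b - 1)" by linarith
    moreover have "sibuya b 1 = p / 4" "sibuya_excess b 1 = 2 * b - 1"
      by (simp_all add: sibuya_def sibuya_excess_def b_def)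
    ultimately show ?thesis unfolding True by (simp only:)
  next
    case False
    then have x2: "x \<ge> 2" using x by simp
    have "(2 - b)\<^sup>2 \<le> (5/4)\<^sup>2" using b by (intro power_mono) auto
    then have "(2 - b)\<^sup>2 \<le> 2" by (simp add: power2_eq_square)
    then have "(1 - b) * (2 - b)\<^sup>2 \<le> p / 4 * 2"
      using p by (intro mult_mono) (auto simp: b_def)
    then have "2 / (p / 4 * 2) \<le> 4 * (2 * b - 1) / ((1 - b) * (2 - b)\<^sup>2)"
      using b p by (intro frac_le) auto
    then have R: "4 / p \<le> 4 * (2 * b - 1) / ((1 - b) * (2 - b)\<^sup>2)" (is "_ \<le> ?R") by simp
    have "(1 - p) * (sibuya b x)\<^sup>2 \<le> 2 * (sibuya b x)\<^sup>2"
      using p by (intro mult_right_mono) auto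
    also have "\<dots> = p * ((sibuya b x)\<^sup>2 * (4 / p) * (1/2))" using p by simp
    also have "\<dots> \<le> p * ((sibuya b x)\<^sup>2 * ?R * (real x / (2 * (real x - 1))))"
      using R p x2 b by (intro mult_left_mono mult_mono) (auto simp: divide_simps)
    also have "\<dots> \<le> p * sibuya_excess b x"
      using sibuya_excess_lower[of b x] p b x2 by (intro mult_left_mono) auto
    finally show ?thesis .
  qed
  then show ?thesis using b by (simp add: sub_exponents_def flip: b_def)
qed

text \<open>The inequality at x = 1 already excludes \<open>b\<close> near 1/2, where 2b - 1
  vanishes while (1 - b)^2 does not. This keeps \<beta> away from 1/2, hence the final exponent
  below 1.\<close>

lemma sub_exponents_lower:
  assumes p: "0 < p" "p < 1" and "b \<in> sub_exponents p"
  shows "min (3/4) (1/2 + (1 - p) / (32 * p)) \<le> b"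
proof (rule ccontr)
  assume "\<not> ?thesis"
  then have b: "b < 3/4" "b < 1/2 + (1 - p) / (32 * p)" by auto
  have "(1 - p) * (sibuya b 1)\<^sup>2 \<le> p * sibuya_excess b 1"
    using assms by (auto simp: sub_exponents_def)
  then have "(1 - p) * (1 - b)\<^sup>2 \<le> p * (2 * b - 1)"
    by (simp add: sibuya_def sibuya_excess_def)
  moreover have "(1/4)\<^sup>2 \<le> (1 - b)\<^sup>2" using b by (intro power_mono) auto
  then have "(1 - p) * (1/16) \<le> (1 - p) * (1 - b)\<^sup>2"
    using p by (intro mult_left_mono) (auto simp: power2_eq_square)
  moreover have "p * (2 * b - 1) < p * ((1 - p) / (16 * p))"
    using p b by (intro mult_strict_left_mono) (auto simp: field_simps)
  moreover have "p * ((1 - p) / (16 * p)) = (1 - p) * (1/16)" using p by simp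
  ultimately show False by linarith
qed

text \<open>For fixed \<open>x\<close> both sides are polynomials in \<open>b\<close>, so the
  inequalities survive the passage to the infimum. The strict bounds 1/2 and 1 survive by
  \<open>sub_exponents_lower\<close> and \<open>sub_exponents_nonempty\<close>.\<close>

lemma tail_exponent_mem:
  assumes p: "0 < p" "p < 1"
  shows "tail_exponent p \<in> sub_exponents p"
proof -
  let ?l = "min (3/4) (1/2 + (1 - p) / (32 * p))"
  let ?C = "{b. \<forall>x\<ge>1. (1 - p) * (sibuya b x)\<^sup>2 \<le> p * sibuya_excess b x}"
  have ne: "sub_exponents p \<noteq> {}" using sub_exponents_nonempty[OF p] by auto
  have bdd: "bdd_below (sub_exponents p)"
    using sub_exponents_lower[OF p] by (intro bdd_belowI) auto
  have "?l \<le> tail_exponent p"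
    unfolding tail_exponent_def using sub_exponents_lower[OF p] by (intro cInf_greatest ne) auto
  moreover have "1/2 < ?l" using p by simp
  ultimately have "1/2 < tail_exponent p" by linarith
  moreover have "tail_exponent p \<le> 1 - p / 4"
    unfolding tail_exponent_def by (intro cInf_lower sub_exponents_nonempty p bdd)
  moreover have "closed ?C"
    unfolding sibuya_def sibuya_excess_def pochhammer_prod
    by (intro closed_Collect_all closed_Collect_imp closed_Collect_le continuous_intros) auto
  then have "closure (sub_exponents p) \<subseteq> ?C"
    by (intro closure_minimal) (auto simp: sub_exponents_def)
  then have "tail_exponent p \<in> ?C"
    using closure_contains_Inf[OF ne bdd] unfolding tail_exponent_def by blast
  ultimately show ?thesis using p by (auto simp: sub_exponents_def)
qed

lemma tail_exponent_bounds:
  assumes "0 < p" "p < 1"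
  shows "1/2 < tail_exponent p" "tail_exponent p < 1"
  using tail_exponent_mem[OF assms] by (auto simp: sub_exponents_def)

text \<open>The inequality defining \<open>sub_exponents\<close> fails at some \<open>x0\<close>,
  and the failure persists: since c (c - 2b) <= (c - b)^2, one step multiplies
  \<open>sibuya_excess b\<close> by no more than it multiplies the square of
  \<open>sibuya b\<close>.\<close>

lemma below_tail_exponent:
  assumes p: "0 < p" "p < 1" and b: "1/2 < b" "b < tail_exponent p"
  obtains x0 where "x0 \<ge> 1" "\<And>x. x \<ge> x0 \<Longrightarrow> p * sibuya_excess b x \<le> (1 - p) * (sibuya b x)\<^sup>2"
proof -
  have b1: "b < 1" using b tail_exponent_bounds[OF p] by linarith
  have "b \<notin> sub_exponents p"
  proof
    assume "b \<in> sub_exponents p"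
    then have "tail_exponent p \<le> b"
      unfolding tail_exponent_def using sub_exponents_lower[OF p]
      by (intro cInf_lower bdd_belowI) auto
    then show False using b by simp
  qed
  then obtain x0 where x0: "x0 \<ge> 1" "p * sibuya_excess b x0 < (1 - p) * (sibuya b x0)\<^sup>2"
    using b b1 by (auto simp: sub_exponents_def not_le)
  have "p * sibuya_excess b x \<le> (1 - p) * (sibuya b x)\<^sup>2" if "x \<ge> x0" for x
    using that
  proof (induction x rule: nat_induct_at_least)
    case base
    then show ?case using x0 by simp
  next
    case (Suc x)
    define c where "c = real x + 1"
    have x: "x \<ge> 1" using Suc x0 by simp
    then have c: "c \<ge> 2" by (simp add: c_def)
    have "(c - 2 * b) * c \<le> (c - b)\<^sup>2" by (simp add: power2_eq_square algebra_simps)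
    then have key: "(c - 2 * b) / c \<le> ((c - b) / c)\<^sup>2"
      using c by (simp add: power_divide divide_simps power2_eq_square)
    have "p * sibuya_excess b (Suc x) = p * sibuya_excess b x * ((c - 2 * b) / c)"
      using x by (simp add: sibuya_excess_Suc c_def)
    also have "\<dots> \<le> (1 - p) * (sibuya b x)\<^sup>2 * ((c - b) / c)\<^sup>2"
      using c b b1 p by (intro mult_mono[OF Suc.IH key]) auto
    also have "\<dots> = (1 - p) * (sibuya b (Suc x))\<^sup>2"
      by (simp only: sibuya_Suc c_def power_mult_distrib mult.assoc)
    finally show ?case .
  qed
  then show ?thesis using x0 that by blast
qed

lemma quadratic_le_cancel:
  fixes u v p :: real
  assumes "0 < p" "p < 1" "0 \<le> u" "0 \<le> v" "2 * p * u + (1 - p) * u\<^sup>2 \<le> 2 * p * v + (1 - p) * v\<^sup>2"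
  shows "u \<le> v"
proof (rule ccontr)
  assume "\<not> u \<le> v"
  then have "v < u" by simp
  then have "2 * p * v < 2 * p * u" "(1 - p) * v\<^sup>2 \<le> (1 - p) * u\<^sup>2"
    using assms by (auto intro!: mult_left_mono power_mono)
  then show False using assms by linarith
qed

text \<open>The equation satisfied by the tail \<open>G\<close> of the longest positive subtree of a critical
  Galton--Watson tree. Its right-hand side only involves values of \<open>G\<close> before \<open>x\<close> and is monotone
  in them, whence a comparison principle.\<close>

locale tail_equation =
  fixes p :: real and G :: "nat \<Rightarrow> real"
  assumes p: "0 < p" "p < 1"
    and G0: "G 0 = 1"
    and G_nonneg: "0 \<le> G x"
    and G_antimono: "antimono G"
    and G_eq: "x \<ge> 1 \<Longrightarrow> 2 * p * G x + (1 - p) * (G x)\<^sup>2 = p * sum_tail G G x"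
begin

lemma G_le_1: "G x \<le> 1"
  using antimonoD[OF G_antimono, of 0 x] by (simp add: G0)

lemma sibuya_le_G:
  assumes b: "b \<in> sub_exponents p"
  shows "sibuya b x \<le> G x"
proof (induction x rule: less_induct)
  case (less x)
  have b1: "1/2 < b" "b < 1" using b by (auto simp: sub_exponents_def)
  show ?case
  proof (cases "x = 0")
    case False
    then have x: "x \<ge> 1" by simp
    have "2 * p * sibuya b x + (1 - p) * (sibuya b x)\<^sup>2 \<le> p * (2 * sibuya b x + sibuya_excess b x)"
      using b x by (auto simp: sub_exponents_def algebra_simps)
    also have "2 * sibuya b x + sibuya_excess b x = sum_tail (sibuya b) (sibuya b) x"
      using x by (simp add: sum_tail_eq_excess excess_sibuya)
    also have "p * \<dots> \<le> p * sum_tail G G x"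
      using p b1 x less
      by (intro mult_left_mono sum_tail_mono sibuya_antimono G_antimono G_nonneg)
         (auto intro!: less_imp_le[OF sibuya_pos])
    also have "\<dots> = 2 * p * G x + (1 - p) * (G x)\<^sup>2" by (simp add: G_eq[OF x])
    finally show ?thesis
      using sibuya_pos[OF b1(2), of x] by (intro quadratic_le_cancel[OF p _ G_nonneg]) simp_all
  qed (simp add: G0)
qed

text \<open>Scaling by \<open>C\<close> preserves the supersolution inequality, which is homogeneous
  of degree two. The cap at 1 restores the value 1 at 0, and \<open>C\<close> is chosen so that the
  cap covers all \<open>x\<close> before \<open>x0\<close>, where nothing is assumed.\<close>

lemma G_le_sibuya:
  assumes b: "1/2 < b" "b < 1" and x0: "x0 \<ge> 1"
    and super: "\<And>x. x \<ge> x0 \<Longrightarrow> p * sibuya_excess b x \<le> (1 - p) * (sibuya b x)\<^sup>2"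
  shows "G x \<le> sibuya b x / sibuya b x0"
proof -
  define C where "C = 1 / sibuya b x0"
  define K where "K x = min 1 (C * sibuya b x)" for x
  have anti: "antimono (sibuya b)" using b by (intro sibuya_antimono) auto
  have C: "C \<ge> 1" using antimonoD[OF anti, of 0 x0] sibuya_pos[OF b(2), of x0] by (simp add: C_def)
  have antiC: "antimono (\<lambda>x. C * sibuya b x)"
    using anti C by (auto simp: antimono_def intro!: mult_left_mono)
  have antiK: "antimono K"
    using antiC unfolding K_def antimono_def by (auto simp: min_le_iff_disj)
  have K0: "K 0 = 1" using C by (simp add: K_def)
  have K_nonneg: "0 \<le> K x" for x
    using C sibuya_pos[OF b(2), of x] by (simp add: K_def)
  have "G x \<le> K x" for x
  proof (induction x rule: less_induct)
    case (less x)
    show ?case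
    proof (cases "C * sibuya b x \<ge> 1")
      case True
      then show ?thesis using G_le_1 by (simp add: K_def)
    next
      case False
      then have Kx: "K x = C * sibuya b x" by (simp add: K_def)
      have x: "x \<ge> x0"
      proof (rule ccontr)
        assume "\<not> x0 \<le> x"
        then have "sibuya b x0 \<le> sibuya b x" using antimonoD[OF anti] by simp
        then show False using False sibuya_pos[OF b(2), of x0] by (simp add: C_def)
      qed
      then have x1: "x \<ge> 1" using x0 by simp
      have "excess (\<lambda>x. C * sibuya b x) (\<lambda>x. C * sibuya b x) x = C\<^sup>2 * sibuya_excess b x"
        unfolding excess_sibuya[OF x1, symmetric] excess_def right_diff_distrib sum_distrib_left
        by (simp add: power2_eq_square mult_ac)
      \<comment> \<open>The cap is inactive at \<open>x\<close>, so \<open>K\<close> agrees there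
        with its uncapped version and \<open>excess_mono\<close> applies.\<close>
      then have exc: "excess K K x \<le> C\<^sup>2 * sibuya_excess b x"
        using excess_mono[OF antiK antiC, of x] by (simp add: Kx) (simp add: K_def)
      have "2 * p * G x + (1 - p) * (G x)\<^sup>2 = p * sum_tail G G x" by (rule G_eq[OF x1])
      also have "\<dots> \<le> p * sum_tail K K x"
        using p less by (intro mult_left_mono sum_tail_mono x1 G_antimono G_nonneg antiK K_nonneg) auto
      also have "\<dots> = 2 * p * K x + p * excess K K x"
        by (simp add: sum_tail_eq_excess[where A=K, OF x1 K0] algebra_simps)
      also have "\<dots> \<le> 2 * p * K x + p * (C\<^sup>2 * sibuya_excess b x)"
        using p exc by (intro add_left_mono mult_left_mono) auto
      also have "p * (C\<^sup>2 * sibuya_excess b x) \<le> C\<^sup>2 * ((1 - p) * (sibuya b x)\<^sup>2)"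
        using mult_left_mono[OF super[OF x], of "C\<^sup>2"] by (simp add: mult_ac)
      also have "\<dots> = (1 - p) * (K x)\<^sup>2" by (simp add: Kx power_mult_distrib)
      finally have "2 * p * G x + (1 - p) * (G x)\<^sup>2 \<le> 2 * p * K x + (1 - p) * (K x)\<^sup>2" by simp
      then show ?thesis by (rule quadratic_le_cancel[OF p G_nonneg K_nonneg])
    qed
  qed
  then show ?thesis by (auto simp: K_def C_def)
qed

lemma G_lower:
  assumes "x \<ge> 1"
  shows "(1 - tail_exponent p) * real x powr (- tail_exponent p) \<le> G x"
  using sibuya_lower[of "tail_exponent p" x] sibuya_le_G[OF tail_exponent_mem[OF p], of x]
    tail_exponent_bounds[OF p] assms by linarith

lemma G_upper:
  assumes b: "1/2 < b" "b < tail_exponent p"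
  obtains C where "C > 0" "\<And>x. G x \<le> C * real (Suc x) powr (-b)"
proof -
  have b1: "b < 1" using b tail_exponent_bounds[OF p] by linarith
  obtain x0 where x0: "x0 \<ge> 1" "\<And>x. x \<ge> x0 \<Longrightarrow> p * sibuya_excess b x \<le> (1 - p) * (sibuya b x)\<^sup>2"
    using below_tail_exponent[OF p b] by blast
  have pos: "sibuya b x0 > 0" by (rule sibuya_pos[OF b1])
  have "G x \<le> 1 / sibuya b x0 * real (Suc x) powr (-b)" for x
  proof -
    have "G x \<le> sibuya b x / sibuya b x0" by (rule G_le_sibuya[OF b(1) b1 x0])
    also have "\<dots> \<le> real (Suc x) powr (-b) / sibuya b x0"
      using pos b b1 by (intro divide_right_mono sibuya_upper) auto
    finally show ?thesis by simp
  qed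
  then show ?thesis using that[of "1 / sibuya b x0"] pos by simp
qed

end

section \<open>Laws with a Catalan branching recursion\<close>

text \<open>The tail of \<open>LIS\<close> at a node whose subtrees have independent values with
  tails \<open>A\<close> and \<open>B\<close>: a sum at a plus, a maximum at a minus.\<close>

definition node_tail :: "real \<Rightarrow> (nat \<Rightarrow> real) \<Rightarrow> (nat \<Rightarrow> real) \<Rightarrow> nat \<Rightarrow> real" where
  "node_tail p A B x = p * sum_tail A B x + (1 - p) * (A x + B x - A x * B x)"

lemma node_tail_commute: "node_tail p A B x = node_tail p B A x"
  by (simp add: node_tail_def sum_tail_commute[of A B] mult.commute add.commute)

lemma node_tail_mono_right:
  assumes "0 < p" "p < 1" "x \<ge> 1" "antimono A" "\<And>y. 0 \<le> A y" "\<And>y. A y \<le> 1" "\<And>y. B y \<le> B' y"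
  shows "node_tail p A B x \<le> node_tail p A B' x"
proof -
  have "B x * (1 - A x) \<le> B' x * (1 - A x)" using assms by (intro mult_right_mono) auto
  then show ?thesis
    unfolding node_tail_def using assms
    by (intro add_mono mult_left_mono sum_tail_mono_right) (auto simp: algebra_simps)
qed

lemma node_tail_ge_max:
  assumes "0 < p" "p < 1" "x \<ge> 1" "antimono A" "antimono B" "A 0 = 1" "B 0 = 1" "\<And>y. B y \<le> 1"
  shows "node_tail p A B x \<ge> 1 - (1 - A x) * (1 - B x)"
proof -
  have "p * (A x + B x - A x * B x) \<le> p * sum_tail A B x"
    using assms by (intro mult_left_mono sum_tail_ge_max) auto
  then show ?thesis by (simp add: node_tail_def algebra_simps)
qed

text \<open>\<open>q n x\<close> stands for \<open>P(LIS(T\<^sub>n) > x)\<close>, and \<open>M1\<close>, \<open>M2\<close> for the first two moments of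
  \<open>LIS(T\<^sub>n)\<close>.\<close>

locale catalan_law =
  fixes p :: real and q :: "nat \<Rightarrow> nat \<Rightarrow> real" and M1 M2 :: "nat \<Rightarrow> real"
  assumes p: "0 < p" "p < 1"
    and q_one: "x \<ge> 1 \<Longrightarrow> q 1 x = 0"
    and q_0: "n \<ge> 1 \<Longrightarrow> q n 0 = 1"
    and q_antimono: "antimono (q n)"
    and q_nonneg: "0 \<le> q n x"
    and q_rec: "n \<ge> 2 \<Longrightarrow> x \<ge> 1 \<Longrightarrow>
      2 * nu n * q n x = (\<Sum>k=1..<n. nu k * nu (n - k) * node_tail p (q k) (q (n - k)) x)"
    and Markov: "n \<ge> 1 \<Longrightarrow> (real x + 1) * q n x \<le> M1 n"
    and M1_split: "n \<ge> 1 \<Longrightarrow> s > 0 \<Longrightarrow> M1 n \<le> real y + M2 n / (2 * s) + s * q n y / 2"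
    and M1_nonneg: "0 \<le> M1 n"
    and M2_one: "M2 1 \<le> 1"
    and M2_rec: "n \<ge> 2 \<Longrightarrow>
      2 * nu n * M2 n \<le> (\<Sum>k=1..<n. nu k * nu (n - k) * (M2 k + M2 (n - k) + 2 * M1 k * M1 (n - k)))"
begin

section \<open>Stochastic monotonicity in the size\<close>

lemma q_le_1: "n \<ge> 1 \<Longrightarrow> q n x \<le> 1"
  using antimonoD[OF q_antimono[of n], of 0 x] q_0[of n] by simp

text \<open>Joining a single leaf to a tree at a new root does not lower the value. This handles the
  boundary term of the leaf-removal identity.\<close>

lemma q_le_node_tail_one:
  assumes "n \<ge> 1" "x \<ge> 1"
  shows "q n x \<le> node_tail p (q 1) (q n) x"
proof -
  have "1 - (1 - q 1 x) * (1 - q n x) \<le> node_tail p (q 1) (q n) x"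
    using assms p by (intro node_tail_ge_max q_antimono q_0 q_le_1) auto
  then show ?thesis using q_one[OF assms(2)] by (simp only: diff_0_right mult_1)
qed

text \<open>The recursion at size \<open>n\<close>, multiplied by n - 1 and rewritten with the
  weights 2 j - 1, is compared termwise with the recursion at n + 1 in its leaf-removed form: the
  induction hypothesis enlarges the left part from \<open>j\<close> to j + 1.\<close>

lemma q_mono_Suc: "n \<ge> 1 \<Longrightarrow> q n x \<le> q (Suc n) x"
proof (induction n arbitrary: x rule: less_induct)
  case (less n)
  show ?case
  proof (cases "x = 0")
    case True
    then show ?thesis using less.prems by (simp add: q_0)
  next
    case False
    then have x: "x \<ge> 1" by simp
    let ?\<phi> = "\<lambda>i j. node_tail p (q i) (q j) x"
    have sym: "?\<phi> i j = ?\<phi> j i" for i j by (rule node_tail_commute)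
    have "(real n - 1) * (2 * nu n * q n x) = (real n - 1) * (\<Sum>j=1..<n. nu j * nu (n - j) * ?\<phi> j (n - j))"
      using q_rec[of n x] x less.prems by (cases "n = 1") auto
    also have "\<dots> = (\<Sum>j=1..<n. (2 * real j - 1) * (nu j * nu (n - j) * ?\<phi> j (n - j)))"
      by (subst sum_antidiagonal_odd[of "\<lambda>i j. nu i * nu j * ?\<phi> i j"])
         (auto simp: mult_ac node_tail_commute)
    also have "\<dots> \<le> (\<Sum>j=1..<n. (2 * real j - 1) * (nu j * nu (n - j) * ?\<phi> (Suc j) (n - j)))"
    proof (intro sum_mono mult_left_mono)
      fix j assume j: "j \<in> {1..<n}"
      have "?\<phi> (n - j) j \<le> ?\<phi> (n - j) (Suc j)"
        using j less.IH x p by (intro node_tail_mono_right q_antimono q_nonneg q_le_1) auto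
      then show "?\<phi> j (n - j) \<le> ?\<phi> (Suc j) (n - j)" by (simp add: node_tail_commute)
    qed (auto simp: nu_nonneg)
    finally have "(2 * real n - 1) * (nu n * q n x)
        \<le> nu n * q n x + (\<Sum>j=1..<n. (2 * real j - 1) * (nu j * nu (n - j) * ?\<phi> (Suc j) (n - j)))"
      by (simp add: algebra_simps)
    also have "nu n * q n x \<le> nu n * ?\<phi> 1 n"
      using less.prems x by (intro mult_left_mono q_le_node_tail_one nu_nonneg)
    also have "nu n * ?\<phi> 1 n + (\<Sum>j=1..<n. (2 * real j - 1) * (nu j * nu (n - j) * ?\<phi> (Suc j) (n - j)))
      = (real n + 1) * (2 * nu (Suc n) * q (Suc n) x)"
      using nu_convolution_shift[of ?\<phi> n, OF sym less.prems] q_rec[of "Suc n" x] x less.prems by simp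
    finally have "(2 * real n - 1) * nu n * q n x \<le> (real n + 1) * nu (Suc n) * 2 * q (Suc n) x"
      by (simp only: mult_ac)
    also have "(real n + 1) * nu (Suc n) * 2 = (2 * real n - 1) * nu n"
      using nu_Suc[OF less.prems] by (simp add: algebra_simps)
    finally show ?thesis
      using nu_pos[OF less.prems] less.prems by simp
  qed
qed

lemma q_mono:
  assumes "m \<ge> 1" "m \<le> n"
  shows "q m x \<le> q n x"
  using assms(2)
proof (induction n rule: nat_induct_at_least)
  case (Suc n)
  then show ?case using q_mono_Suc[of n x] assms by simp
qed simp

section \<open>The tail for a critical Galton--Watson tree and its equation\<close>

definition G :: "nat \<Rightarrow> real" where
  "G x = (\<Sum>n. nu n * q n x)"

lemma nu_q_le: "nu n * q n x \<le> nu n"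
  using q_le_1[of n x] nu_nonneg[of n] by (cases "n = 0") (auto intro: mult_left_le)

lemma nu_q_nonneg: "0 \<le> nu n * q n x"
  by (simp add: nu_nonneg q_nonneg)

lemma summable_nu_q: "summable (\<lambda>n. nu n * q n x)"
  by (rule summable_comparison_test'[OF sums_summable[OF nu_sums], of 0])
     (use nu_q_le nu_q_nonneg in auto)

lemma nu_q_product_sums:
  "(\<lambda>n. \<Sum>k\<le>n. (nu k * q k x) * (nu (n - k) * q (n - k) y)) sums (G x * G y)"
  unfolding G_def using summable_nu_q nu_q_nonneg
  by (intro Cauchy_product_sums) auto

lemma G_0: "G 0 = 1"
proof -
  have "nu n * q n 0 = nu n" for n using q_0[of n] by (cases "n = 0") auto
  then show ?thesis using sums_unique[OF nu_sums] by (simp only: G_def)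
qed

lemma G_equation:
  assumes x: "x \<ge> 1"
  shows "2 * p * G x + (1 - p) * (G x)\<^sup>2 = p * sum_tail G G x"
proof -
  define c where "c u v n = (\<Sum>k\<le>n. (nu k * q k u) * (nu (n - k) * q (n - k) v))" for u v n
  have c: "(\<lambda>n. c u v n) sums (G u * G v)" for u v
    unfolding c_def by (rule nu_q_product_sums)
  \<comment> \<open>Factors \<open>q k 0 = 1\<close> are inserted into the linear terms of the
    maximum, so that every term is a Cauchy product and sums to a product of two values of
    \<open>G\<close>.\<close>
  have rec: "2 * (nu n * q n x) = p * ((\<Sum>i<x. c i (x - 1 - i) n) - (\<Sum>i=1..<x. c i (x - i) n))
      + (1 - p) * (c x 0 n + c 0 x n - c x x n)" for n
  proof -
    have "2 * (nu n * q n x) = (\<Sum>k\<le>n. nu k * nu (n - k) * node_tail p (q k) (q (n - k)) x)"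
    proof (cases "n \<ge> 2")
      case True
      have "(\<Sum>k\<le>n. nu k * nu (n - k) * node_tail p (q k) (q (n - k)) x)
        = (\<Sum>k=1..<n. nu k * nu (n - k) * node_tail p (q k) (q (n - k)) x)"
        using True by (intro sum.mono_neutral_right) (auto simp: Suc_le_eq not_less)
      then show ?thesis using q_rec[OF True x] by simp
    next
      case False
      then have "n = 0 \<or> n = 1" by auto
      then show ?thesis using q_one[OF x] by auto
    qed
    also have "\<dots> = (\<Sum>k\<le>n. p * ((\<Sum>i<x. (nu k * q k i) * (nu (n - k) * q (n - k) (x - 1 - i)))
         - (\<Sum>i=1..<x. (nu k * q k i) * (nu (n - k) * q (n - k) (x - i))))
      + (1 - p) * ((nu k * q k x) * (nu (n - k) * q (n - k) 0) + (nu k * q k 0) * (nu (n - k) * q (n - k) x)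
         - (nu k * q k x) * (nu (n - k) * q (n - k) x)))"
    proof (intro sum.cong refl)
      fix k assume "k \<in> {..n}"
      show "nu k * nu (n - k) * node_tail p (q k) (q (n - k)) x =
        p * ((\<Sum>i<x. (nu k * q k i) * (nu (n - k) * q (n - k) (x - 1 - i)))
         - (\<Sum>i=1..<x. (nu k * q k i) * (nu (n - k) * q (n - k) (x - i))))
      + (1 - p) * ((nu k * q k x) * (nu (n - k) * q (n - k) 0) + (nu k * q k 0) * (nu (n - k) * q (n - k) x)
         - (nu k * q k x) * (nu (n - k) * q (n - k) x))"
      proof (cases "k = 0 \<or> n - k = 0")
        case True
        then show ?thesis by (elim disjE) simp_all
      next
        case False
        then have "q k 0 = 1" "q (n - k) 0 = 1" by (auto intro!: q_0)
        then show ?thesis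
          by (simp add: node_tail_def sum_tail_def distrib_left right_diff_distrib sum_distrib_left mult_ac)
      qed
    qed
    also have "\<dots> = p * ((\<Sum>i<x. c i (x - 1 - i) n) - (\<Sum>i=1..<x. c i (x - i) n))
      + (1 - p) * (c x 0 n + c 0 x n - c x x n)"
      unfolding c_def sum.distrib sum_subtractf sum_distrib_left[symmetric]
      by (subst (1 3) sum.swap) (rule refl)
    finally show ?thesis .
  qed
  have "(\<lambda>n. 2 * (nu n * q n x)) sums (p * ((\<Sum>i<x. G i * G (x - 1 - i)) - (\<Sum>i=1..<x. G i * G (x - i)))
      + (1 - p) * (G x * G 0 + G 0 * G x - G x * G x))"
    unfolding rec by (intro sums_add sums_diff sums_mult sums_sum c)
  moreover have "(\<lambda>n. 2 * (nu n * q n x)) sums (2 * G x)"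
    unfolding G_def by (intro sums_mult summable_sums summable_nu_q)
  ultimately have "2 * G x = p * sum_tail G G x + (1 - p) * (G x * G 0 + G 0 * G x - G x * G x)"
    unfolding sum_tail_def by (rule sums_unique2[rotated])
  then show ?thesis by (simp add: G_0 power2_eq_square algebra_simps)
qed

sublocale tail_equation p G
proof
  show "antimono G"
    unfolding G_def
    by (intro antimonoI suminf_le summable_nu_q mult_left_mono nu_nonneg antimonoD[OF q_antimono])
  show "0 \<le> G x" for x
    unfolding G_def by (intro suminf_nonneg summable_nu_q nu_q_nonneg)
qed (use p G_0 G_equation in auto)

abbreviation \<beta> :: real where "\<beta> \<equiv> tail_exponent p"

lemma \<beta>_bounds: "1/2 < \<beta>" "\<beta> < 1"
  by (rule tail_exponent_bounds[OF p])+

section \<open>Comparison of fixed size with random size\<close>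

lemma G_split:
  "G x = (\<Sum>k. nu (k + n) * q (k + n) x) + (\<Sum>k<n. nu k * q k x)"
  unfolding G_def by (rule suminf_split_initial_segment[OF summable_nu_q])

lemma summable_nu_q_shift: "summable (\<lambda>k. nu (k + n) * q (k + n) x)"
  using summable_nu_q summable_iff_shift[of "\<lambda>k. nu k * q k x" n] by simp

text \<open>Only sizes at least \<open>n\<close> are kept, and by monotonicity each of them has at
  least the tail of size \<open>n\<close>.\<close>

lemma q_times_tail_le_G:
  assumes "n \<ge> 1"
  shows "q n x * (2 * real n * nu n) \<le> G x"
proof -
  have s: "(\<lambda>k. q n x * nu (k + n)) sums (q n x * (2 * real n * nu n))"
    by (intro sums_mult nu_tail_sums assms)
  have "q n x * (2 * real n * nu n) = (\<Sum>k. q n x * nu (k + n))" by (rule sums_unique[OF s])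
  also have "\<dots> \<le> (\<Sum>k. nu (k + n) * q (k + n) x)"
  proof (intro suminf_le summable_nu_q_shift sums_summable[OF s])
    fix k
    have "nu (k + n) * q n x \<le> nu (k + n) * q (k + n) x"
      using assms by (intro mult_left_mono nu_nonneg q_mono) auto
    then show "q n x * nu (k + n) \<le> nu (k + n) * q (k + n) x" by (simp only: mult.commute)
  qed
  also have "\<dots> \<le> G x"
    unfolding G_split[of x n] using nu_q_nonneg by (simp add: sum_nonneg)
  finally show ?thesis .
qed

text \<open>Sizes from \<open>k0\<close> up to \<open>m\<close> are dominated by size
  \<open>m\<close> through monotonicity; for larger sizes the tail is bounded by 1.\<close>

lemma G_le_split:
  assumes "1 \<le> k0" "k0 \<le> m"
  shows "G x \<le> (\<Sum>k<k0. nu k * q k x) + q m x * (2 * real k0 * nu k0) + 2 * real m * nu m"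
proof -
  let ?t = "\<lambda>k. if m \<le> k then nu k else 0"
  have s1: "(\<lambda>k. q m x * nu (k + k0)) sums (q m x * (2 * real k0 * nu k0))"
    by (intro sums_mult nu_tail_sums assms)
  have "(\<lambda>k. ?t (k + m)) sums (2 * real m * nu m)"
    using nu_tail_sums[of m] assms by simp
  then have "?t sums (2 * real m * nu m + (\<Sum>k<m. ?t k))"
    by (subst (asm) sums_iff_shift) simp
  then have "?t sums (2 * real m * nu m + (\<Sum>k<k0. ?t k))"
    using assms by simp
  then have s2: "(\<lambda>k. ?t (k + k0)) sums (2 * real m * nu m)"
    by (subst sums_iff_shift) simp
  have "(\<Sum>k. nu (k + k0) * q (k + k0) x) \<le> (\<Sum>k. q m x * nu (k + k0) + ?t (k + k0))"
  proof (intro suminf_le summable_nu_q_shift sums_summable[OF sums_add[OF s1 s2]])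
    fix k
    show "nu (k + k0) * q (k + k0) x \<le> q m x * nu (k + k0) + ?t (k + k0)"
    proof (cases "m \<le> k + k0")
      case True
      have "0 \<le> q m x * nu (k + k0)" by (simp add: q_nonneg nu_nonneg)
      then show ?thesis using True nu_q_le[of "k + k0" x] by simp
    next
      case False
      then have "nu (k + k0) * q (k + k0) x \<le> nu (k + k0) * q m x"
        using assms by (intro mult_left_mono q_mono nu_nonneg) auto
      then show ?thesis using False by (simp add: mult.commute)
    qed
  qed
  also have "\<dots> = q m x * (2 * real k0 * nu k0) + 2 * real m * nu m"
    using sums_unique[OF sums_add[OF s1 s2]] by simp
  finally show ?thesis unfolding G_split[of x k0] by simp
qed

end

section \<open>Moment bounds\<close>

lemma powr_split_le:
  fixes a :: real
  assumes a: "1/2 < a" "a < 1" and k: "k \<in> {1..<n}"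
  shows "real k powr (2 * a) + real (n - k) powr (2 * a)
    \<le> real n powr (2 * a) * (1 - 2 * (2 * a - 1) * (real k * real (n - k) / (real n)\<^sup>2))"
proof -
  \<comment> \<open>Bernoulli's inequality for u^(2a-1) makes strict convexity quantitative, with a
    deficit proportional to u (1 - u).\<close>
  have one: "(u * real n) powr (2 * a) \<le> real n powr (2 * a) * (u - (2 * a - 1) * (u * (1 - u)))"
    if u: "0 < u" "u < 1" for u :: real
  proof -
    have "u powr (2 * a) = u * u powr (2 * a - 1)"
      using u powr_add[of u 1 "2 * a - 1"] by simp
    also have "\<dots> \<le> u * (1 - (2 * a - 1) * (1 - u))"
      using u a by (intro mult_left_mono powr_Bernoulli_concave) auto
    also have "\<dots> = u - (2 * a - 1) * (u * (1 - u))" by (simp add: algebra_simps)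
    finally have "real n powr (2 * a) * u powr (2 * a) \<le> real n powr (2 * a) * (u - (2 * a - 1) * (u * (1 - u)))"
      by (intro mult_left_mono) auto
    then show ?thesis by (simp add: powr_mult mult.commute)
  qed
  define u where "u = real k / real n"
  have u: "0 < u" "u < 1" using k by (auto simp: u_def)
  have kn: "real k = u * real n" "real (n - k) = (1 - u) * real n"
    using k by (auto simp: u_def field_simps)
  have "real k powr (2 * a) + real (n - k) powr (2 * a)
    \<le> real n powr (2 * a) * (u - (2 * a - 1) * (u * (1 - u)))
      + real n powr (2 * a) * ((1 - u) - (2 * a - 1) * ((1 - u) * (1 - (1 - u))))"
    unfolding kn using u by (intro add_mono one) auto
  also have "\<dots> = real n powr (2 * a) * (1 - 2 * (2 * a - 1) * (u * (1 - u)))"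
    by (simp add: algebra_simps)
  also have "u * (1 - u) = real k * real (n - k) / (real n)\<^sup>2"
    using k unfolding kn by (simp add: power2_eq_square)
  finally show ?thesis .
qed

context catalan_law
begin

text \<open>The convexity deficit of \<open>powr_split_le\<close> pays for the cross term 2
  \<open>M1 k * M1 (n - k)\<close>: summed over splits both have order n^(2a-2), and
  \<open>C0\<close> dominates the quotient of their constants. \<open>M1_bound\<close> relies on
  \<open>C0\<close> being chosen before \<open>D\<close>, and on the hypothesis concerning smaller
  sizes only.\<close>

lemma M2_bound:
  fixes a :: real
  assumes a: "1/2 < a" "a < 1"
  obtains C0 where "C0 \<ge> 1" "\<And>D n. D \<ge> 1 \<Longrightarrow> n \<ge> 1 \<Longrightarrow> (\<And>k. k \<in> {1..<n} \<Longrightarrow> M1 k \<le> D * real k powr a) \<Longrightarrow>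
    M2 n \<le> C0 * D\<^sup>2 * real n powr (2 * a)"
proof -
  define Ca where "Ca = 2 powr (1/2 - a) / (a - 1/2)"
  define C0 where "C0 = max 1 (16 * Ca / (2 * a - 1))"
  have C0: "C0 \<ge> 1" "Ca \<le> C0 * (2 * a - 1) / 16"
  proof -
    have "16 * Ca / (2 * a - 1) \<le> C0" by (simp add: C0_def)
    then show "Ca \<le> C0 * (2 * a - 1) / 16" using a by (simp add: pos_divide_le_eq mult.commute)
  qed (simp add: C0_def)
  have "M2 n \<le> C0 * D\<^sup>2 * real n powr (2 * a)"
    if D: "D \<ge> 1" and n: "n \<ge> 1" and M1D: "\<And>k. k \<in> {1..<n} \<Longrightarrow> M1 k \<le> D * real k powr a" for D n
    using n M1D
  proof (induction n rule: less_induct)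
    case (less n)
    show ?case
    proof (cases "n = 1")
      case True
      have "1 * 1 \<le> C0 * D\<^sup>2" using C0 D by (intro mult_mono) (auto simp: one_le_power)
      then show ?thesis using True M2_one by simp
    next
      case False
      then have n2: "n \<ge> 2" using less.prems by simp
      define X where "X = real n powr (2 * a)"
      define W where "W k = real k * real (n - k) / (real n)\<^sup>2" for k
      define V where "V k = (real k * real (n - k)) powr a" for k
      define E where "E = (\<Sum>k=1..<n. nu k * nu (n - k) * W k)"
      define F where "F = (\<Sum>k=1..<n. nu k * nu (n - k) * V k)"
      have pointwise: "M2 k + M2 (n - k) + 2 * M1 k * M1 (n - k)
        \<le> C0 * D\<^sup>2 * X - 2 * C0 * D\<^sup>2 * X * (2 * a - 1) * W k
          + 2 * D\<^sup>2 * V k" if k: "k \<in> {1..<n}" for k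
      proof -
        have "M2 k \<le> C0 * D\<^sup>2 * real k powr (2 * a)" "M2 (n - k) \<le> C0 * D\<^sup>2 * real (n - k) powr (2 * a)"
          using k less.prems(2) by (intro less.IH; auto)+
        then have "M2 k + M2 (n - k) \<le> C0 * D\<^sup>2 * (real k powr (2 * a) + real (n - k) powr (2 * a))"
          by (simp add: distrib_left)
        also have "\<dots> \<le> C0 * D\<^sup>2 * (X * (1 - 2 * (2 * a - 1) * W k))"
          unfolding X_def W_def using C0 by (intro mult_left_mono powr_split_le a k) auto
        finally have *: "M2 k + M2 (n - k) \<le> \<dots>" .
        have "M1 k * M1 (n - k) \<le> (D * real k powr a) * (D * real (n - k) powr a)"
          using k D by (intro mult_mono less.prems M1_nonneg) auto
        also have "\<dots> = D\<^sup>2 * V k"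
          by (simp add: V_def powr_mult power2_eq_square)
        finally have "2 * M1 k * M1 (n - k) \<le> 2 * D\<^sup>2 * V k" by simp
        moreover have eq: "C0 * D\<^sup>2 * (X * (1 - 2 * (2 * a - 1) * t))
          = C0 * D\<^sup>2 * X - 2 * C0 * D\<^sup>2 * X * (2 * a - 1) * t" for t
          by (simp add: algebra_simps)
        ultimately show ?thesis using *[unfolded eq] by linarith
      qed
      have "2 * nu n * M2 n \<le> (\<Sum>k=1..<n. nu k * nu (n - k) * (C0 * D\<^sup>2 * X
          - 2 * C0 * D\<^sup>2 * X * (2 * a - 1) * W k
          + 2 * D\<^sup>2 * V k))"
        by (rule order_trans[OF M2_rec[OF n2]]) (intro sum_mono mult_left_mono pointwise, auto simp: nu_nonneg)
      also have "\<dots> = C0 * D\<^sup>2 * X * (\<Sum>k=1..<n. nu k * nu (n - k))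
          - 2 * C0 * D\<^sup>2 * X * (2 * a - 1) * E + 2 * D\<^sup>2 * F"
        unfolding E_def F_def sum_distrib_left sum_subtractf[symmetric] sum.distrib[symmetric]
        by (intro sum.cong refl) (simp add: distrib_left right_diff_distrib mult_ac)
      also have "(\<Sum>k=1..<n. nu k * nu (n - k)) = 2 * nu n" by (rule nu_convolution[OF n2])
      finally have main: "2 * nu n * M2 n
        \<le> C0 * D\<^sup>2 * X * (2 * nu n) - 2 * D\<^sup>2 * (C0 * (2 * a - 1) * X * E) + 2 * D\<^sup>2 * F"
        by (simp only: mult_ac)
      have "F \<le> Ca * real n powr (2 * a - 2)"
        unfolding F_def Ca_def V_def using a by (intro sum_nu_split_upper) auto
      also have "\<dots> \<le> C0 * (2 * a - 1) / 16 * real n powr (2 * a - 2)"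
        using C0 by (intro mult_right_mono) auto
      also have "real n powr (2 * a - 2) = X * real n powr (-2)"
        unfolding X_def by (simp flip: powr_add)
      also have "C0 * (2 * a - 1) / 16 * (X * real n powr (-2)) = C0 * (2 * a - 1) * X * (1 / 16 * real n powr (-2))"
        by simp
      also have "\<dots> \<le> C0 * (2 * a - 1) * X * E"
        unfolding E_def W_def using C0 a by (intro mult_left_mono sum_nu_split_lower n2) (auto simp: X_def)
      finally have "2 * D\<^sup>2 * F \<le> 2 * D\<^sup>2 * (C0 * (2 * a - 1) * X * E)"
        by (intro mult_left_mono) auto
      then have "2 * nu n * M2 n \<le> 2 * nu n * (C0 * D\<^sup>2 * X)"
        using main by (simp add: mult_ac)
      then show ?thesis using nu_pos[of n] n2 by (simp add: X_def)
    qed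
  qed
  then show ?thesis using that C0(1) by blast
qed

text \<open>Truncation at K n^a leaves D n^a / 2 below the level, and the part above contributes two
  quarters. \<open>K\<close> depends on \<open>C\<close> and \<open>C0\<close> but not on
  \<open>D\<close>, so setting D = 2 K afterwards is not circular.\<close>

lemma M1_bound:
  assumes b: "1/2 < b" "b < \<beta>"
  obtains D where "D > 0" "\<And>n. n \<ge> 1 \<Longrightarrow> M1 n \<le> D * real n powr (1 / (2 * b))"
proof -
  define a where "a = 1 / (2 * b)"
  have b1: "b < 1" using b \<beta>_bounds by linarith
  have a: "1/2 < a" "a < 1" using b b1 by (auto simp: a_def field_simps)
  obtain C where C: "C > 0" "\<And>x. G x \<le> C * real (Suc x) powr (-b)" using G_upper[OF b] by blast
  obtain C0 where C0: "C0 \<ge> 1" "\<And>D n. D \<ge> 1 \<Longrightarrow> n \<ge> 1 \<Longrightarrow> (\<And>k. k \<in> {1..<n} \<Longrightarrow> M1 k \<le> D * real k powr a) \<Longrightarrow>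
    M2 n \<le> C0 * D\<^sup>2 * real n powr (2 * a)" using M2_bound[OF a] by metis
  define K where "K = max 1 ((8 * C * C0) powr (1 / b))"
  have K: "K \<ge> 1" by (simp add: K_def)
  have "8 * C * C0 = ((8 * C * C0) powr (1 / b)) powr b"
    using b C C0 by (simp add: powr_powr)
  also have "\<dots> \<le> K powr b" using b by (intro powr_mono2) (auto simp: K_def)
  finally have Kb: "8 * C * C0 * K powr (-b) \<le> 1"
    using K by (simp add: powr_minus field_simps)
  define D where "D = 2 * K"
  have D: "D \<ge> 1" using K by (simp add: D_def)
  \<comment> \<open>Since a b = 1/2, the bound on \<open>G\<close> at K n^a has the same order in
    \<open>n\<close> as the probability of size at least \<open>n\<close>; the quotient is a
    constant that a large \<open>K\<close> makes small.\<close>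
  have qb: "q n y \<le> 2 * C * K powr (-b)" if n: "n \<ge> 1" and y: "real (Suc y) \<ge> K * real n powr a" for n y
  proof -
    have "q n y * (real n powr (-(1/2)) / 2) \<le> q n y * (2 * real n * nu n)"
      using n by (intro mult_left_mono nu_tail_lower q_nonneg)
    also have "\<dots> \<le> G y" by (rule q_times_tail_le_G[OF n])
    also have "\<dots> \<le> C * real (Suc y) powr (-b)" by (rule C)
    also have "\<dots> \<le> C * (K * real n powr a) powr (-b)"
      using C K n y b by (intro mult_left_mono powr_mono2') auto
    also have "(K * real n powr a) powr (-b) = K powr (-b) * real n powr (-(1/2))"
      using b by (simp add: powr_mult powr_powr a_def)
    finally have "q n y * real n powr (-(1/2)) \<le> 2 * C * K powr (-b) * real n powr (-(1/2))"
      by simp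
    then show ?thesis using n by simp
  qed
  have "M1 n \<le> D * real n powr a" if "n \<ge> 1" for n
    using that
  proof (induction n rule: less_induct)
    case (less n)
    define X where "X = real n powr a"
    have X: "X > 0" using less.prems by (simp add: X_def)
    define y where "y = nat \<lfloor>K * X\<rfloor>"
    have y: "real y \<le> K * X" "K * X \<le> real (Suc y)"
      using K X by (simp_all add: y_def floor_le_iff le_nat_iff) linarith
    have q: "q n y \<le> 2 * C * K powr (-b)"
      using qb[OF less.prems, of y] y by (simp add: X_def)
    have M2: "M2 n \<le> C0 * D\<^sup>2 * X\<^sup>2"
      using C0(2)[OF D less.prems less.IH] by (simp add: X_def powr_powr mult.commute flip: powr_realpow')
    \<comment> \<open>This \<open>s\<close> makes the second-moment term D X / 4, and the choice of
      \<open>K\<close> makes the tail term at most D X / 4.\<close>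
    define s where "s = 2 * C0 * D * X"
    have s: "s > 0" using C0 D X by (simp add: s_def)
    have "M1 n \<le> real y + M2 n / (2 * s) + s * q n y / 2" by (rule M1_split[OF less.prems s])
    also have "M2 n / (2 * s) \<le> C0 * D\<^sup>2 * X\<^sup>2 / (2 * s)"
      using M2 s by (intro divide_right_mono) auto
    also have "\<dots> = D * X / 4"
      using C0 D X by (simp add: s_def power2_eq_square)
    also have "s * q n y / 2 \<le> s * (2 * C * K powr (-b)) / 2"
      using q s by (intro divide_right_mono mult_left_mono) auto
    also have "\<dots> = (8 * C * C0 * K powr (-b)) * (D * X / 4)"
      by (simp add: s_def)
    also have "\<dots> \<le> 1 * (D * X / 4)"
      using D X by (intro mult_right_mono Kb) auto
    finally show ?case using y(1) by (simp add: D_def X_def)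
  qed
  then show ?thesis using that[of D] D by (auto simp: a_def)
qed

text \<open>The value exceeds \<open>x\<close> as soon as it does so in one root subtree, so a
  failure requires both to fail. Induction on the larger subtree costs slightly more than the bound
  at \<open>n\<close>, but a smaller one with between \<open>m\<close> and 2 m leaves gains a factor
  1 - \<delta>. Gain and cost balance when \<delta> m (2 m n)^(-3/2) / 16 equals 2 sqrt 2 / n^2,
  that is at \<delta> sqrt n = 128 sqrt m; for smaller \<open>n\<close> the bound is
  trivial.\<close>

lemma bootstrap:
  assumes x: "x \<ge> 1" and m: "m \<ge> 1" and \<delta>: "0 < \<delta>" "\<delta> \<le> q m x" and "n \<ge> 1"
  shows "1 - q n x \<le> 128 * sqrt (real m) / \<delta> / sqrt (real n)"
proof -
  define B where "B = 128 * sqrt (real m) / \<delta>"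
  have \<delta>1: "\<delta> \<le> 1" using \<delta> q_le_1[OF m, of x] by linarith
  have B: "B > 0" using m \<delta> by (simp add: B_def)
  have B_ge: "128 * sqrt (real m) \<le> B"
    using m \<delta> \<delta>1 frac_le[of "128 * sqrt (real m)" "128 * sqrt (real m)" \<delta> 1] by (simp add: B_def)
  show ?thesis
    unfolding B_def[symmetric] using \<open>n \<ge> 1\<close>
  proof (induction n rule: less_induct)
    case (less n)
    have q01: "0 \<le> 1 - q k x" "1 - q k x \<le> 1" if "k \<ge> 1" for k
      using q_le_1[OF that, of x] q_nonneg[of k x] by auto
    show ?case
    proof (cases "sqrt (real n) \<le> B")
      case True
      then have "1 \<le> B / sqrt (real n)" using less.prems by simp
      then show ?thesis using q01[OF less.prems] by linarith
    next
      case False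
      have "16384 * real m = (128 * sqrt (real m))\<^sup>2" by (simp add: power_mult_distrib)
      also have "\<dots> \<le> (sqrt (real n))\<^sup>2" using False B_ge by (intro power_mono) auto
      finally have "16384 * m \<le> n" by (simp flip: of_nat_le_iff)
      then have n4: "4 * m \<le> n" and n2: "n \<ge> 2" using m by auto
      define r where "r = B / sqrt (real n)"
      have r: "r > 0" using B less.prems by (simp add: r_def)
      \<comment> \<open>Sizes in this window inherit \<delta> from size \<open>m\<close> by
        monotonicity, and \<open>4 * m \<le> n\<close> keeps the window on the side of the smaller
        subtree.\<close>
      define ind :: "nat \<Rightarrow> real" where "ind k = (if k \<in> {m..<2 * m} then 1 else 0)" for k
      define w where "w k = real k * real (n - k) / (real n)\<^sup>2" for k
      have side: "(1 - q j x) * (1 - q l x) \<le> r * (1 + 2 * w j - \<delta> * ind j)"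
        if "1 \<le> j" "j \<le> l" "j + l = n" for j l
      proof -
        define v where "v = real j / real n"
        have v: "0 < v" "v \<le> 1/2" using that by (auto simp: v_def field_simps)
        have l: "real l = (1 - v) * real n" using that by (auto simp: v_def field_simps)
        have w: "w j = v * (1 - v)"
        proof -
          have "n - j = l" using that by simp
          then show ?thesis
            unfolding w_def using that by (simp add: l) (simp add: v_def power2_eq_square)
        qed
        have "1 \<le> (1 + v)\<^sup>2 * (1 - v)"
        proof -
          have "v * v \<le> v * (1/2)" "v * (v * v) \<le> v * (1/2 * 1)"
            using v by (intro mult_left_mono mult_mono; simp)+
          then show ?thesis by (simp add: power2_eq_square algebra_simps)
        qed
        then have "sqrt 1 \<le> sqrt ((1 + v)\<^sup>2 * (1 - v))" by (rule real_sqrt_le_mono)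
        then have sq: "1 / sqrt (1 - v) \<le> 1 + v"
          using v by (simp add: real_sqrt_mult divide_le_eq)
        have "1 - q l x \<le> B / sqrt (real l)"
          using that by (intro less.IH) auto
        also have "\<dots> = r * (1 / sqrt (1 - v))"
          unfolding l by (simp add: r_def real_sqrt_mult mult.commute)
        also have "\<dots> \<le> r * (1 + v)" using r sq by (intro mult_left_mono) auto
        finally have ql: "1 - q l x \<le> r * (1 + v)" .
        have qj: "1 - q j x \<le> 1 - \<delta> * ind j"
        proof (cases "j \<in> {m..<2 * m}")
          case True
          then have "\<delta> \<le> q j x" using q_mono[OF m, of j x] \<delta> by auto
          then show ?thesis using True by (simp add: ind_def)
        next
          case False
          then show ?thesis using q01[OF that(1)] by (auto simp: ind_def)
        qed
        have "(1 - q j x) * (1 - q l x) \<le> (1 - \<delta> * ind j) * (r * (1 + v))"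
          using that r v q01 qj ql \<delta> \<delta>1 by (intro mult_mono) (auto simp: ind_def)
        also have "\<dots> = r * ((1 - \<delta> * ind j) * (1 + v))" by (simp add: mult_ac)
        \<comment> \<open>As v <= 1/2, the cost \<open>v\<close> is at most 2 v (1 - v) =
          \<open>2 * w j\<close>, which is symmetric in the two parts.\<close>
        also have "\<dots> \<le> r * (1 + 2 * w j - \<delta> * ind j)"
        proof (intro mult_left_mono)
          have "0 \<le> \<delta> * ind j * v" using \<delta> v by (simp add: ind_def)
          moreover have "v * v \<le> v * (1/2)" using v by (intro mult_left_mono) auto
          ultimately show "(1 - \<delta> * ind j) * (1 + v) \<le> 1 + 2 * w j - \<delta> * ind j"
            unfolding w by (simp add: algebra_simps)
        qed (use r in auto)
        finally show ?thesis .
      qed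
      have pointwise: "(1 - q k x) * (1 - q (n - k) x) \<le> r * (1 + 2 * w k - \<delta> * ind k)"
        if k: "k \<in> {1..<n}" for k
      proof (cases "k \<le> n - k")
        case True
        then show ?thesis using side[of k "n - k"] k by auto
      next
        case False
        have "w (n - k) = w k" using k by (simp add: w_def mult.commute)
        moreover have "ind k = 0" "0 \<le> ind (n - k)" using False n4 by (auto simp: ind_def)
        moreover have "(1 - q (n - k) x) * (1 - q k x) \<le> r * (1 + 2 * w (n - k) - \<delta> * ind (n - k))"
          using False k by (intro side) auto
        moreover have "r * (1 + 2 * w (n - k) - \<delta> * ind (n - k)) \<le> r * (1 + 2 * w (n - k))"
          using r \<delta> by (intro mult_left_mono) (auto simp: ind_def)
        ultimately show ?thesis by (simp add: mult.commute)
      qed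
      have "2 * nu n * (1 - q n x) = (\<Sum>k=1..<n. nu k * nu (n - k) * (1 - node_tail p (q k) (q (n - k)) x))"
        using q_rec[OF n2 x] nu_convolution[OF n2] by (simp add: right_diff_distrib sum_subtractf)
      also have "\<dots> \<le> (\<Sum>k=1..<n. nu k * nu (n - k) * (r * (1 + 2 * w k - \<delta> * ind k)))"
      proof (intro sum_mono mult_left_mono)
        fix k assume k: "k \<in> {1..<n}"
        have "1 - (1 - q k x) * (1 - q (n - k) x) \<le> node_tail p (q k) (q (n - k)) x"
          using k x p by (intro node_tail_ge_max q_antimono q_0 q_le_1) auto
        then show "1 - node_tail p (q k) (q (n - k)) x \<le> r * (1 + 2 * w k - \<delta> * ind k)"
          using pointwise[OF k] by linarith
      qed (auto simp: nu_nonneg)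
      also have "\<dots> = r * ((\<Sum>k=1..<n. nu k * nu (n - k)) + 2 * (\<Sum>k=1..<n. nu k * nu (n - k) * w k)
          - \<delta> * (\<Sum>k=1..<n. nu k * nu (n - k) * ind k))"
        unfolding sum_distrib_left sum_subtractf[symmetric] sum.distrib[symmetric]
        by (intro sum.cong refl) (simp add: distrib_left right_diff_distrib mult_ac)
      also have "\<dots> \<le> r * (2 * nu n)"
      proof (intro mult_left_mono)
        have "(\<Sum>k=1..<n. nu k * nu (n - k) * w k)
          = (\<Sum>k=1..<n. nu k * nu (n - k) * (real k * real (n - k)) powr 1) / (real n)\<^sup>2"
          unfolding sum_divide_distrib w_def by (intro sum.cong refl) (simp del: of_nat_diff)
        also have "\<dots> \<le> (2 powr (1/2 - 1) / (1 - 1/2) * real n powr (2 * 1 - 2)) / (real n)\<^sup>2"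
          by (intro divide_right_mono sum_nu_split_upper) auto
        also have "2 powr (1/2 - 1) / (1 - 1/2) = sqrt (2::real)"
        proof -
          have "2 powr (1/2 - 1) = 1 / sqrt (2::real)" by (simp add: powr_minus_divide powr_half_sqrt)
          then show ?thesis using real_div_sqrt[of 2] by simp
        qed
        finally have up: "(\<Sum>k=1..<n. nu k * nu (n - k) * w k) \<le> sqrt 2 / (real n)\<^sup>2"
          using n2 by simp
        define z where "z = 2 * real m * real n"
        have z: "z > 0" using m n2 by (simp add: z_def)
        have "real m * (z powr (-(3/2)) / 16) = (\<Sum>k\<in>{m..<2 * m}. z powr (-(3/2)) / 16)"
          by simp
        also have "\<dots> \<le> (\<Sum>k\<in>{m..<2 * m}. nu k * nu (n - k) * ind k)"
        proof (rule sum_mono)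
          fix k assume k: "k \<in> {m..<2 * m}"
          then have k': "k \<in> {1..<n}" using m n4 by auto
          have "z powr (-(3/2)) / 16 \<le> (real k * real (n - k)) powr (-(3/2)) / 16"
            using k k' by (intro divide_right_mono powr_mono2' order.refl) (auto simp: z_def intro!: mult_mono)
          also have "\<dots> \<le> nu k * nu (n - k)" by (rule nu_mult_lower[OF k'])
          finally show "z powr (-(3/2)) / 16 \<le> nu k * nu (n - k) * ind k" using k by (simp add: ind_def)
        qed
        also have "\<dots> \<le> (\<Sum>k=1..<n. nu k * nu (n - k) * ind k)"
          using m n4 by (intro sum_mono2) (auto simp: ind_def nu_nonneg)
        finally have "\<delta> * (real m * (z powr (-(3/2)) / 16)) \<le> \<delta> * (\<Sum>k=1..<n. nu k * nu (n - k) * ind k)"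
          using \<delta> by (intro mult_left_mono) auto
        moreover have "2 * (sqrt 2 / (real n)\<^sup>2) \<le> \<delta> * (real m * (z powr (-(3/2)) / 16))"
        proof -
          define N where "N = sqrt (real n)"
          define M where "M = sqrt (real m)"
          have N: "N > 0" "real n = N\<^sup>2" and M: "M > 0" "real m = M\<^sup>2"
            using n2 m by (auto simp: N_def M_def)
          have "128 * M \<le> \<delta> * N"
            using False \<delta> by (simp add: B_def N_def M_def field_simps)
          then have "128 * M / (32 * sqrt 2 * M * N ^ 4) \<le> \<delta> * N / (32 * sqrt 2 * M * N ^ 4)"
            using N M by (intro divide_right_mono) auto
          moreover have "128 * M / (32 * sqrt 2 * M * N ^ 4) = 2 * (sqrt 2 / (real n)\<^sup>2)"
            using N M by (simp add: field_simps power2_eq_square power4_eq_xxxx)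
          moreover have "\<delta> * (real m * (z powr (-(3/2)) / 16)) = \<delta> * N / (32 * sqrt 2 * M * N ^ 4)"
            using N M unfolding powr_three_halves[OF z]
            by (simp add: z_def real_sqrt_mult power2_eq_square power4_eq_xxxx)
          ultimately show ?thesis by (simp only:)
        qed
        ultimately show "(\<Sum>k=1..<n. nu k * nu (n - k)) + 2 * (\<Sum>k=1..<n. nu k * nu (n - k) * w k)
          - \<delta> * (\<Sum>k=1..<n. nu k * nu (n - k) * ind k) \<le> 2 * nu n"
          using up nu_convolution[OF n2] by linarith
      qed (use r in auto)
      finally have "(2 * nu n) * (1 - q n x) \<le> (2 * nu n) * r" by (simp only: mult_ac)
      then have "1 - q n x \<le> r" by (rule mult_left_le_imp_le) (use nu_pos[of n] n2 in auto)
      then show ?thesis by (simp only: r_def)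
    qed
  qed
qed

lemma M1_bound_exponent:
  assumes "1 / (2 * \<beta>) < a" "a < 1"
  obtains D where "D > 0" "\<And>n. n \<ge> 1 \<Longrightarrow> M1 n \<le> D * real n powr a"
proof -
  have a0: "a > 0" using assms(1) \<beta>_bounds by (auto elim: less_trans[rotated])
  have "1/2 < 1 / (2 * a)" "1 / (2 * a) < \<beta>"
    using assms a0 \<beta>_bounds by (auto simp: field_simps)
  then obtain D where "D > 0" "\<And>n. n \<ge> 1 \<Longrightarrow> M1 n \<le> D * real n powr (1 / (2 * (1 / (2 * a))))"
    by (rule M1_bound) blast
  then show ?thesis using that by simp
qed

text \<open>The lower bound on \<open>G\<close> is split by size at x^t0 and x^t1, just below and
  above x^(2\<beta>). Small sizes are negligible by Markov's inequality, large ones by their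
  probability. The remaining sizes have probability at most x^(-\<beta>(1-\<eta>)) and must carry
  order x^(-\<beta>), which leaves x^(-\<beta>\<eta>) for the conditional tail.\<close>

lemma seed:
  assumes \<eta>: "0 < \<eta>" "\<eta> < 1"
  obtains c where "c > 0"
    "\<forall>\<^sub>F x in sequentially. c * real x powr (- (\<beta> * \<eta>)) \<le> q (nat \<lceil>real x powr (2 * \<beta> * (1 + \<eta>))\<rceil>) x"
proof -
  note b = \<beta>_bounds
  define t0 where "t0 = 2 * \<beta> * (1 - \<eta>)"
  define t1 where "t1 = 2 * \<beta> * (1 + \<eta>)"
  have t: "0 < t0" "t0 \<le> t1" using b \<eta> by (auto simp: t0_def t1_def)
  have "1 / (2 * \<beta>) < 1" using b by simp
  \<comment> \<open>With 2 \<beta> in place of \<open>t0\<close> this would be an equality, so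
    \<eta> > 0 creates the room for \<open>a\<close>. The upper bound on \<open>a\<close> is what
    makes the contribution of small sizes o(x^(-\<beta>)).\<close>
  moreover have "1 / (2 * \<beta>) < 1/2 + (1 - \<beta>) / t0"
  proof -
    have "t0 < 2 * \<beta>" using b \<eta> by (simp add: t0_def algebra_simps)
    then have "(1 - \<beta>) / (2 * \<beta>) < (1 - \<beta>) / t0" using b t by (intro divide_strict_left_mono) auto
    moreover have "1 / (2 * \<beta>) = 1/2 + (1 - \<beta>) / (2 * \<beta>)" using b by (simp add: field_simps)
    ultimately show ?thesis by linarith
  qed
  ultimately obtain a where a: "1 / (2 * \<beta>) < a" "a < min 1 (1/2 + (1 - \<beta>) / t0)"
    using dense[of "1 / (2 * \<beta>)" "min 1 (1/2 + (1 - \<beta>) / t0)"] by auto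
  have "1/2 < 1 / (2 * \<beta>)" using b by (simp add: field_simps)
  then have a_half: "1/2 < a" using a by linarith
  have e: "t0 * (a - 1/2) < 1 - \<beta>"
  proof -
    have "a - 1/2 < (1 - \<beta>) / t0" using a by simp
    then show ?thesis using t by (simp add: pos_less_divide_eq mult.commute)
  qed
  obtain D where D: "D > 0" "\<And>n. n \<ge> 1 \<Longrightarrow> M1 n \<le> D * real n powr a"
    using M1_bound_exponent[of a] a by auto
  define C' where "C' = D / (2 * (a - 1/2))"
  have bound: "((1 - \<beta>) - C' * real x powr (t0 * (a - 1/2) - 1 + \<beta>) - real x powr (- (\<beta> * \<eta>))) * real x powr (- (\<beta> * \<eta>))
      \<le> q (nat \<lceil>real x powr t1\<rceil>) x" if x: "x \<ge> 1" for x
  proof -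
    define X where "X = real x"
    have X: "X \<ge> 1" using x by (simp add: X_def)
    define k0 where "k0 = nat \<lceil>X powr t0\<rceil>"
    define m where "m = nat \<lceil>X powr t1\<rceil>"
    have X0: "X powr t0 \<ge> 1" "X powr t0 \<le> X powr t1"
      using X t by (auto intro!: ge_one_powr_ge_zero powr_mono)
    have k0: "1 \<le> k0" "k0 \<le> m" "X powr t0 \<le> real k0" "real k0 - 1 \<le> X powr t0" "X powr t1 \<le> real m"
      using X0 unfolding k0_def m_def by (auto simp: nat_mono ceiling_mono le_nat_iff) linarith+
    have "(\<Sum>k<k0. nu k * q k x) \<le> C' * X powr (t0 * (a - 1/2) - 1)"
    proof -
      have "(\<Sum>k<k0. nu k * q k x) = (\<Sum>k=1..k0 - 1. nu k * q k x)"
        using k0(1) by (intro sum.mono_neutral_right) (auto simp: Suc_le_eq)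
      also have "\<dots> \<le> (\<Sum>k=1..k0 - 1. D / (2 * X) * real k powr (a - 3/2))"
      proof (rule sum_mono)
        fix k assume k: "k \<in> {1..k0 - 1}"
        have "X * q k x \<le> (real x + 1) * q k x" by (simp add: X_def algebra_simps q_nonneg)
        also have "\<dots> \<le> D * real k powr a" using Markov[of k x] D(2)[of k] k by auto
        finally have "q k x \<le> D * real k powr a / X" using X by (simp add: field_simps)
        then have "nu k * q k x \<le> (real k powr (-(3/2)) / 2) * (D * real k powr a / X)"
          using k by (intro mult_mono nu_upper q_nonneg) auto
        also have "\<dots> = D / (2 * X) * (real k powr a * real k powr (-(3/2)))" by simp
        also have "real k powr a * real k powr (-(3/2)) = real k powr (a - 3/2)"
          by (simp flip: powr_add)
        finally show "nu k * q k x \<le> D / (2 * X) * real k powr (a - 3/2)" .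
      qed
      also have "\<dots> \<le> D / (2 * X) * (real (k0 - 1) powr (a - 3/2 + 1) / (a - 3/2 + 1))"
        unfolding sum_distrib_left[symmetric] using D X a a_half
        by (intro mult_left_mono sum_powr_le) auto
      also have "\<dots> \<le> D / (2 * X) * ((X powr t0) powr (a - 1/2) / (a - 1/2))"
        using D X a_half k0 by (intro mult_left_mono) (auto intro!: divide_right_mono powr_mono2 simp: of_nat_diff)
      also have "\<dots> = C' * (X powr (t0 * (a - 1/2)) / X)"
        by (simp add: C'_def powr_powr)
      also have "X powr (t0 * (a - 1/2)) / X = X powr (t0 * (a - 1/2) - 1)"
        using X by (simp add: powr_diff)
      finally show ?thesis .
    qed
    moreover have "2 * real k0 * nu k0 \<le> X powr (- (\<beta> * (1 - \<eta>)))"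
    proof -
      have "2 * real k0 * nu k0 \<le> real k0 powr (-(1/2))" by (rule nu_tail_upper[OF k0(1)])
      also have "\<dots> \<le> (X powr t0) powr (-(1/2))" using X k0 by (intro powr_mono2') auto
      finally show ?thesis by (simp add: powr_powr t0_def)
    qed
    then have "q m x * (2 * real k0 * nu k0) \<le> q m x * X powr (- (\<beta> * (1 - \<eta>)))"
      by (intro mult_left_mono q_nonneg)
    moreover have "2 * real m * nu m \<le> X powr (- (\<beta> * (1 + \<eta>)))"
    proof -
      have "2 * real m * nu m \<le> real m powr (-(1/2))" using k0 by (intro nu_tail_upper) auto
      also have "\<dots> \<le> (X powr t1) powr (-(1/2))" using X k0 by (intro powr_mono2') auto
      finally show ?thesis by (simp add: powr_powr t1_def)
    qed
    moreover have "(1 - \<beta>) * X powr (- \<beta>) \<le> G x" unfolding X_def by (rule G_lower[OF x])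
    ultimately have "(1 - \<beta>) * X powr (- \<beta>) - C' * X powr (t0 * (a - 1/2) - 1) - X powr (- (\<beta> * (1 + \<eta>)))
        \<le> q m x * X powr (- (\<beta> * (1 - \<eta>)))"
      using G_le_split[OF k0(1,2), of x] by linarith
    then have "((1 - \<beta>) * X powr (- \<beta>) - C' * X powr (t0 * (a - 1/2) - 1) - X powr (- (\<beta> * (1 + \<eta>)))) * X powr (\<beta> * (1 - \<eta>))
        \<le> q m x * X powr (- (\<beta> * (1 - \<eta>))) * X powr (\<beta> * (1 - \<eta>))"
      by (intro mult_right_mono) auto
    also have "\<dots> = q m x" using X by (simp add: mult.assoc flip: powr_add)
    also have "((1 - \<beta>) * X powr (- \<beta>) - C' * X powr (t0 * (a - 1/2) - 1) - X powr (- (\<beta> * (1 + \<eta>)))) * X powr (\<beta> * (1 - \<eta>))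
      = ((1 - \<beta>) - C' * X powr (t0 * (a - 1/2) - 1 + \<beta>) - X powr (- (\<beta> * \<eta>))) * X powr (- (\<beta> * \<eta>))"
    proof -
      have "X powr (- \<beta>) * X powr (\<beta> * (1 - \<eta>)) = X powr (- (\<beta> * \<eta>))"
        "X powr (t0 * (a - 1/2) - 1) * X powr (\<beta> * (1 - \<eta>)) = X powr (t0 * (a - 1/2) - 1 + \<beta>) * X powr (- (\<beta> * \<eta>))"
        "X powr (- (\<beta> * (1 + \<eta>))) * X powr (\<beta> * (1 - \<eta>)) = X powr (- (\<beta> * \<eta>)) * X powr (- (\<beta> * \<eta>))"
        by (simp_all flip: powr_add) (simp_all add: algebra_simps)
      then show ?thesis by (simp only: left_diff_distrib mult.assoc)
    qed
    finally show ?thesis unfolding X_def m_def .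
  qed
  have "(\<lambda>x. (1 - \<beta>) - C' * real x powr (t0 * (a - 1/2) - 1 + \<beta>) - real x powr (- (\<beta> * \<eta>))) \<longlonglongrightarrow> (1 - \<beta>) - C' * 0 - 0"
    using e b \<eta> by (intro tendsto_intros tendsto_neg_powr filterlim_real_sequentially) auto
  then have "\<forall>\<^sub>F x in sequentially. (1 - \<beta>) / 2 < (1 - \<beta>) - C' * real x powr (t0 * (a - 1/2) - 1 + \<beta>) - real x powr (- (\<beta> * \<eta>))"
    by (rule order_tendstoD) (use b in auto)
  then have "\<forall>\<^sub>F x in sequentially. (1 - \<beta>) / 2 * real x powr (- (\<beta> * \<eta>)) \<le> q (nat \<lceil>real x powr t1\<rceil>) x"
    using eventually_ge_at_top[of 1]
  proof eventually_elim
    case (elim x)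
    then show ?case by (intro order_trans[OF _ bound[of x]] mult_right_mono) auto
  qed
  then show ?thesis using that[of "(1 - \<beta>) / 2"] b by (simp add: t1_def)
qed

text \<open>\<open>bootstrap\<close> started from \<open>seed\<close>: \<open>m\<close> of order
  x^(2\<beta>(1+\<eta>)) and \<delta> of order x^(-\<beta>\<eta>) give sqrt m / \<delta> of order
  x^(\<beta>(1+2\<eta>)).\<close>

lemma lower_tail_bound:
  assumes \<eta>: "0 < \<eta>" "\<eta> < 1"
  obtains C where "C > 0"
    "\<forall>\<^sub>F x in sequentially. \<forall>n\<ge>1. 1 - q n x \<le> C * real x powr (\<beta> * (1 + 2 * \<eta>)) / sqrt (real n)"
proof -
  note b = \<beta>_bounds
  obtain c where c: "c > 0"
    "\<forall>\<^sub>F x in sequentially. c * real x powr (- (\<beta> * \<eta>)) \<le> q (nat \<lceil>real x powr (2 * \<beta> * (1 + \<eta>))\<rceil>) x"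
    using seed[OF \<eta>] by blast
  have "\<forall>\<^sub>F x in sequentially. \<forall>n\<ge>1. 1 - q n x \<le> 128 * sqrt 2 / c * real x powr (\<beta> * (1 + 2 * \<eta>)) / sqrt (real n)"
    using c(2) eventually_ge_at_top[of 1]
  proof eventually_elim
    case (elim x)
    define m where "m = nat \<lceil>real x powr (2 * \<beta> * (1 + \<eta>))\<rceil>"
    have X: "real x powr (2 * \<beta> * (1 + \<eta>)) \<ge> 1"
      using elim b \<eta> by (intro ge_one_powr_ge_zero) auto
    then have m: "1 \<le> m" "real m \<le> 2 * real x powr (2 * \<beta> * (1 + \<eta>))"
      using elim unfolding m_def by (auto simp: le_nat_iff) linarith
    have "sqrt (real m) \<le> sqrt (2 * real x powr (2 * \<beta> * (1 + \<eta>)))"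
      using m(2) by (rule real_sqrt_le_mono)
    also have "\<dots> = sqrt 2 * real x powr (\<beta> * (1 + \<eta>))"
      using elim by (simp add: real_sqrt_mult powr_powr flip: powr_half_sqrt)
    finally have sm: "sqrt (real m) \<le> sqrt 2 * real x powr (\<beta> * (1 + \<eta>))" .
    show ?case
    proof (intro allI impI)
      fix n :: nat assume n: "1 \<le> n"
      have "1 - q n x \<le> 128 * sqrt (real m) / (c * real x powr (- (\<beta> * \<eta>))) / sqrt (real n)"
        using elim c n m by (intro bootstrap) (auto simp: m_def)
      also have "\<dots> \<le> 128 * (sqrt 2 * real x powr (\<beta> * (1 + \<eta>))) / (c * real x powr (- (\<beta> * \<eta>))) / sqrt (real n)"
        using sm c by (intro divide_right_mono mult_left_mono) auto
      also have "\<dots> = 128 * sqrt 2 / c * (real x powr (\<beta> * (1 + \<eta>)) / real x powr (- (\<beta> * \<eta>))) / sqrt (real n)"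
        by simp
      also have "real x powr (\<beta> * (1 + \<eta>)) / real x powr (- (\<beta> * \<eta>)) = real x powr (\<beta> * (1 + 2 * \<eta>))"
        by (simp flip: powr_diff) (simp add: algebra_simps)
      finally show "1 - q n x \<le> 128 * sqrt 2 / c * real x powr (\<beta> * (1 + 2 * \<eta>)) / sqrt (real n)" .
    qed
  qed
  then show ?thesis using that[of "128 * sqrt 2 / c"] c by simp
qed

section \<open>Limits in probability and the exponent of the mean\<close>

lemma lower_tail_tendsto:
  assumes s: "0 < s" "s < 1 / (2 * \<beta>)"
  shows "(\<lambda>n. 1 - q n (nat \<lceil>real n powr s\<rceil>)) \<longlonglongrightarrow> 0"
proof -
  note b = \<beta>_bounds
  \<comment> \<open>With this choice s \<beta> (1 + 2\<eta>) - 1/2 = -2\<eta> (1 - s \<beta>), which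
    is negative.\<close>
  define \<eta> where "\<eta> = (1/2 - s * \<beta>) / 2"
  have sb: "0 < s * \<beta>" "s * \<beta> < 1/2" using s b by (auto simp: field_simps)
  have \<eta>: "0 < \<eta>" "\<eta> < 1" using sb by (auto simp: \<eta>_def)
  have "s * \<beta> * (2 * \<eta>) \<le> 1/2 * (2 * \<eta>)" using sb \<eta> by (intro mult_right_mono) auto
  moreover have "s * (\<beta> * (1 + 2 * \<eta>)) = s * \<beta> + s * \<beta> * (2 * \<eta>)" by (simp add: algebra_simps)
  moreover have "\<eta> = 1/4 - s * \<beta> / 2" by (simp add: \<eta>_def field_simps)
  ultimately have ex: "s * (\<beta> * (1 + 2 * \<eta>)) - 1/2 < 0" using sb by linarith
  define g where "g = \<beta> * (1 + 2 * \<eta>)"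
  have g: "g > 0" using b \<eta> by (simp add: g_def)
  obtain C where C: "C > 0"
    "\<forall>\<^sub>F x in sequentially. \<forall>n\<ge>1. 1 - q n x \<le> C * real x powr g / sqrt (real n)"
    using lower_tail_bound[OF \<eta>] unfolding g_def by blast
  define X where "X n = nat \<lceil>real n powr s\<rceil>" for n
  have "filterlim (\<lambda>n. real n powr s) at_top sequentially" using s by real_asymp
  then have "filterlim X sequentially sequentially"
    unfolding filterlim_sequentially_iff_filterlim_real
    by (rule filterlim_at_top_mono) (auto simp: X_def intro!: always_eventually real_nat_ceiling_ge)
  then have "\<forall>\<^sub>F n in sequentially. \<forall>k\<ge>1. 1 - q k (X n) \<le> C * real (X n) powr g / sqrt (real k)"
    by (rule eventually_compose_filterlim[OF C(2)])
  then have up: "\<forall>\<^sub>F n in sequentially. 1 - q n (X n) \<le> C * 2 powr g * real n powr (s * g - 1/2)"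
    using eventually_ge_at_top[of 1]
  proof eventually_elim
    case (elim n)
    have "real n powr s \<ge> 1" using elim s by (intro ge_one_powr_ge_zero) auto
    then have "real (X n) \<le> 2 * real n powr s" unfolding X_def by linarith
    then have "real (X n) powr g \<le> (2 * real n powr s) powr g" using g by (intro powr_mono2) auto
    also have "\<dots> = 2 powr g * real n powr (s * g)" by (simp add: powr_mult powr_powr)
    finally have "C * real (X n) powr g / sqrt (real n) \<le> C * (2 powr g * real n powr (s * g)) / sqrt (real n)"
      using C by (intro divide_right_mono mult_left_mono) auto
    also have "\<dots> = C * 2 powr g * (real n powr (s * g) / real n powr (1/2))"
      by (simp add: powr_half_sqrt)
    also have "real n powr (s * g) / real n powr (1/2) = real n powr (s * g - 1/2)"
      by (simp flip: powr_diff)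
    finally show ?case using elim by fastforce
  qed
  have low: "\<forall>\<^sub>F n in sequentially. 0 \<le> 1 - q n (X n)"
    using eventually_ge_at_top[of 1] by eventually_elim (simp add: q_le_1)
  have "(\<lambda>n. C * 2 powr g * real n powr (s * g - 1/2)) \<longlonglongrightarrow> C * 2 powr g * 0"
    using ex unfolding g_def by (intro tendsto_intros tendsto_neg_powr filterlim_real_sequentially) auto
  then have "(\<lambda>n. C * 2 powr g * real n powr (s * g - 1/2)) \<longlonglongrightarrow> 0" by (simp only: mult_zero_right)
  from tendsto_sandwich[OF low up tendsto_const this] show ?thesis unfolding X_def .
qed

lemma upper_tail_tendsto:
  assumes s: "1 / (2 * \<beta>) < s"
  shows "(\<lambda>n. q n (nat \<lfloor>real n powr s\<rfloor>)) \<longlonglongrightarrow> 0"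
proof -
  have "1 / (2 * \<beta>) < min 1 s" using \<beta>_bounds s by simp
  then obtain a where a: "1 / (2 * \<beta>) < a" "a < min 1 s" using dense by blast
  obtain D where D: "D > 0" "\<And>n. n \<ge> 1 \<Longrightarrow> M1 n \<le> D * real n powr a"
    using M1_bound_exponent[of a] a by auto
  have up: "\<forall>\<^sub>F n in sequentially. q n (nat \<lfloor>real n powr s\<rfloor>) \<le> D * real n powr (a - s)"
    using eventually_ge_at_top[of 1]
  proof eventually_elim
    case (elim n)
    have "real n powr s * q n (nat \<lfloor>real n powr s\<rfloor>) \<le> (real (nat \<lfloor>real n powr s\<rfloor>) + 1) * q n (nat \<lfloor>real n powr s\<rfloor>)"
      by (intro mult_right_mono q_nonneg) linarith
    also have "\<dots> \<le> D * real n powr a" using Markov[OF elim] D(2)[OF elim] order_trans by blast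
    finally show ?case using elim by (simp add: powr_diff field_simps)
  qed
  have "(\<lambda>n. D * real n powr (a - s)) \<longlonglongrightarrow> D * 0"
    using a by (intro tendsto_intros tendsto_neg_powr filterlim_real_sequentially) auto
  then have "(\<lambda>n. D * real n powr (a - s)) \<longlonglongrightarrow> 0" by (simp only: mult_zero_right)
  from tendsto_sandwich[OF _ up tendsto_const this] show ?thesis by (simp add: q_nonneg)
qed

text \<open>The limsup of the theorem is thus a limit. From below, the value exceeds n^s' with
  probability at least 1/2 for every s' under the exponent; from above, the moment bound
  applies.\<close>

lemma ln_M1_tendsto: "(\<lambda>n. ln (M1 n) / ln (real n)) \<longlonglongrightarrow> 1 / (2 * \<beta>)"
proof (rule order_tendstoI)
  note b = \<beta>_bounds
  fix s assume s: "s < 1 / (2 * \<beta>)"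
  have "max s 0 < 1 / (2 * \<beta>)" using s b by simp
  then obtain s' where s': "max s 0 < s'" "s' < 1 / (2 * \<beta>)" using dense by blast
  have "\<forall>\<^sub>F n in sequentially. 1 - q n (nat \<lceil>real n powr s'\<rceil>) < 1/2"
    using lower_tail_tendsto[of s'] s' by (intro order_tendstoD) auto
  moreover have "(\<lambda>n. s' - ln 2 / ln (real n)) \<longlonglongrightarrow> s'" by real_asymp
  then have "\<forall>\<^sub>F n in sequentially. s < s' - ln 2 / ln (real n)"
    by (rule order_tendstoD) (use s' in auto)
  ultimately show "\<forall>\<^sub>F n in sequentially. s < ln (M1 n) / ln (real n)"
    using eventually_ge_at_top[of 2]
  proof eventually_elim
    case (elim n)
    define x where "x = nat \<lceil>real n powr s'\<rceil>"
    have "real n powr s' \<le> real x" by (simp add: x_def real_nat_ceiling_ge)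
    then have "real n powr s' * (1/2) \<le> (real x + 1) * q n x"
      using elim by (intro mult_mono) (auto simp: x_def[symmetric])
    also have "\<dots> \<le> M1 n" using elim by (intro Markov) auto
    finally have "real n powr s' / 2 \<le> M1 n" by simp
    then have "ln (real n powr s' / 2) \<le> ln (M1 n)"
      using elim by (intro ln_mono) auto
    then have "s' * ln (real n) - ln 2 \<le> ln (M1 n)"
      using elim by (simp add: ln_div ln_powr)
    then have "(s' * ln (real n) - ln 2) / ln (real n) \<le> ln (M1 n) / ln (real n)"
      using elim by (intro divide_right_mono) auto
    then show ?case using elim by (simp add: diff_divide_distrib)
  qed
next
  note b = \<beta>_bounds
  fix s assume s: "1 / (2 * \<beta>) < s"
  have "1 / (2 * \<beta>) < min 1 s" using b s by simp
  then obtain a where a: "1 / (2 * \<beta>) < a" "a < min 1 s" using dense by blast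
  obtain D where D: "D > 0" "\<And>n. n \<ge> 1 \<Longrightarrow> M1 n \<le> D * real n powr a"
    using M1_bound_exponent[of a] a by auto
  have "(\<lambda>n. a + ln D / ln (real n)) \<longlonglongrightarrow> a" by real_asymp
  then have "\<forall>\<^sub>F n in sequentially. a + ln D / ln (real n) < s"
    by (rule order_tendstoD) (use a in auto)
  then show "\<forall>\<^sub>F n in sequentially. ln (M1 n) / ln (real n) < s"
    using eventually_ge_at_top[of 2]
  proof eventually_elim
    case (elim n)
    have "0 < M1 n" using Markov[of n 0] q_0[of n] elim by simp
    then have "ln (M1 n) \<le> ln (D * real n powr a)"
      using D(2)[of n] elim by (intro ln_mono) auto
    also have "\<dots> = a * ln (real n) + ln D"
      using D elim by (simp add: ln_mult ln_powr)
    finally have "ln (M1 n) / ln (real n) \<le> (a * ln (real n) + ln D) / ln (real n)"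
      using elim by (intro divide_right_mono) auto
    then show ?case using elim by (simp add: add_divide_distrib)
  qed
qed

end

section \<open>The recursion for \<open>LIS\<close>\<close>

lemma finite_leaves: "finite (leaves t)"
  by (induction t) auto

lemma restrict_eq_None_iff: "restrict t L = None \<longleftrightarrow> L \<inter> leaves t = {}"
proof (induction t arbitrary: L)
  case (SNode s l r)
  have "restrict (SNode s l r) L = None \<longleftrightarrow>
      restrict l {xs. False # xs \<in> L} = None \<and> restrict r {xs. True # xs \<in> L} = None"
    by (auto split: option.splits)
  moreover have "L \<inter> leaves (SNode s l r) = {} \<longleftrightarrow>
      {xs. False # xs \<in> L} \<inter> leaves l = {} \<and> {xs. True # xs \<in> L} \<inter> leaves r = {}"
    unfolding leaves.simps by blast
  ultimately show ?case by (simp only: SNode.IH)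
qed auto

text \<open>A positive subtree with leaves on both sides of a node retains that node with its sign,
  so at a minus it must stay within one side.\<close>

fun lis_rec :: "stree \<Rightarrow> nat" where
  "lis_rec SLeaf = 1"
| "lis_rec (SNode s l r) = (if s then lis_rec l + lis_rec r else max (lis_rec l) (lis_rec r))"

lemma card_Cons_union:
  assumes "finite A" "finite B"
  shows "card (Cons False ` A \<union> Cons True ` B) = card A + card B"
  using assms by (subst card_Un_disjoint) (auto simp: card_image)

lemma card_le_lis_rec:
  "L \<subseteq> leaves t \<Longrightarrow> restrict t L = Some u \<Longrightarrow> positive u \<Longrightarrow> card L \<le> lis_rec t"
proof (induction t arbitrary: L u)
  case SLeaf
  then have "card L \<le> card {[] :: bool list}" by (intro card_mono) auto
  then show ?case by simp
next
  case (SNode s l r)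
  define A where "A = {xs. False # xs \<in> L}"
  define B where "B = {xs. True # xs \<in> L}"
  have AB: "A \<subseteq> leaves l" "B \<subseteq> leaves r" using SNode.prems(1) by (auto simp: A_def B_def)
  have fin: "finite A" "finite B" using AB finite_leaves finite_subset by blast+
  have "L = Cons False ` A \<union> Cons True ` B" using SNode.prems(1) by (auto simp: A_def B_def)
  then have card: "card L = card A + card B" using card_Cons_union[OF fin] by simp
  have empty: "A = {}" if "restrict l A = None" using that AB by (auto simp: restrict_eq_None_iff)
  have empty': "B = {}" if "restrict r B = None" using that AB by (auto simp: restrict_eq_None_iff)
  have res: "(case (restrict l A, restrict r B) of
        (None, None) \<Rightarrow> None
      | (Some a, None) \<Rightarrow> Some a
      | (None, Some b) \<Rightarrow> Some b
      | (Some a, Some b) \<Rightarrow> Some (SNode s a b)) = Some u"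
    using SNode.prems(2) by (simp add: A_def B_def)
  show ?case
  proof (cases "restrict l A")
    case None
    then obtain b where b: "restrict r B = Some b" "u = b" using res by (auto split: option.splits)
    then have "card B \<le> lis_rec r" using SNode.IH(2)[OF AB(2) b(1)] SNode.prems(3) by simp
    then show ?thesis using card empty[OF None] by auto
  next
    case (Some a)
    show ?thesis
    proof (cases "restrict r B")
      case None
      then have "card A \<le> lis_rec l" using SNode.IH(1)[OF AB(1) Some] SNode.prems(3) res Some by simp
      then show ?thesis using card empty'[OF None] by auto
    next
      case (Some b)
      then have "u = SNode s a b" using res \<open>restrict l A = Some a\<close> by simp
      then show ?thesis
        using SNode.IH(1)[OF AB(1) \<open>restrict l A = Some a\<close>] SNode.IH(2)[OF AB(2) Some] SNode.prems(3) card
        by simp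
    qed
  qed
qed

lemma lis_rec_attained:
  "\<exists>L u. L \<subseteq> leaves t \<and> L \<noteq> {} \<and> restrict t L = Some u \<and> positive u \<and> card L = lis_rec t"
proof (induction t)
  case SLeaf
  then show ?case by (intro exI[of _ "{[]}"] exI[of _ SLeaf]) auto
next
  case (SNode s l r)
  obtain A a where A: "A \<subseteq> leaves l" "A \<noteq> {}" "restrict l A = Some a" "positive a" "card A = lis_rec l"
    using SNode.IH(1) by blast
  obtain B b where B: "B \<subseteq> leaves r" "B \<noteq> {}" "restrict r B = Some b" "positive b" "card B = lis_rec r"
    using SNode.IH(2) by blast
  have empty: "restrict t {} = None" for t by (simp add: restrict_eq_None_iff)
  have pre: "{xs. False # xs \<in> Cons False ` X \<union> Cons True ` Y} = X"
    "{xs. True # xs \<in> Cons False ` X \<union> Cons True ` Y} = Y" for X Y :: "bool list set" by auto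
  have node: "restrict (SNode s l r) (Cons False ` X \<union> Cons True ` Y) =
     (case (restrict l X, restrict r Y) of
        (None, None) \<Rightarrow> None
      | (Some a, None) \<Rightarrow> Some a
      | (None, Some b) \<Rightarrow> Some b
      | (Some a, Some b) \<Rightarrow> Some (SNode s a b))" for X Y
    by (simp only: restrict.simps pre)
  \<comment> \<open>\<open>X\<close> and \<open>Y\<close> are the parts of the leaf set in the two
    subtrees; at a minus one of them is taken empty.\<close>
  have witness: ?case
    if X: "X \<subseteq> leaves l" "Y \<subseteq> leaves r" "X \<union> Y \<noteq> {}"
      and res: "(case (restrict l X, restrict r Y) of
          (None, None) \<Rightarrow> None
        | (Some a, None) \<Rightarrow> Some a
        | (None, Some b) \<Rightarrow> Some b
        | (Some a, Some b) \<Rightarrow> Some (SNode s a b)) = Some u"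
      and u: "positive u" "card X + card Y = lis_rec (SNode s l r)" for X Y u
  proof (intro exI conjI)
    have "finite X" "finite Y" using X finite_leaves finite_subset by blast+
    then show "card (Cons False ` X \<union> Cons True ` Y) = lis_rec (SNode s l r)"
      using card_Cons_union u by metis
    show "restrict (SNode s l r) (Cons False ` X \<union> Cons True ` Y) = Some u"
      unfolding node by (rule res)
  qed (use X u in auto)
  consider "s" | "\<not> s" "lis_rec r \<le> lis_rec l" | "\<not> s" "lis_rec l \<le> lis_rec r" by linarith
  then show ?case
  proof cases
    case 1
    then show ?thesis using A B by (intro witness[of A B "SNode s a b"]) auto
  next
    case 2
    then show ?thesis using A by (intro witness[of A "{}" a]) (auto simp: empty)
  next
    case 3
    then show ?thesis using B by (intro witness[of "{}" B b]) (auto simp: empty)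
  qed
qed

lemma LIS_eq_lis_rec: "LIS t = lis_rec t"
  unfolding LIS_def
proof (rule Max_eqI)
  show "finite {card L |L. L \<subseteq> leaves t \<and> L \<noteq> {} \<and> (\<exists>u. restrict t L = Some u \<and> positive u)}"
    by (rule finite_subset[of _ "card ` Pow (leaves t)"]) (auto simp: finite_leaves)
next
  fix y assume "y \<in> {card L |L. L \<subseteq> leaves t \<and> L \<noteq> {} \<and> (\<exists>u. restrict t L = Some u \<and> positive u)}"
  then show "y \<le> lis_rec t" using card_le_lis_rec by auto
next
  show "lis_rec t \<in> {card L |L. L \<subseteq> leaves t \<and> L \<noteq> {} \<and> (\<exists>u. restrict t L = Some u \<and> positive u)}"
    using lis_rec_attained[of t] by (metis (mono_tags, lifting) mem_Collect_eq)
qed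

lemma LIS_SLeaf: "LIS SLeaf = 1"
  and LIS_SNode_True: "LIS (SNode True l r) = LIS l + LIS r"
  and LIS_SNode_False: "LIS (SNode False l r) = max (LIS l) (LIS r)"
  by (simp_all add: LIS_eq_lis_rec)

lemma LIS_ge_1: "LIS t \<ge> 1"
  unfolding LIS_eq_lis_rec by (induction t) (auto simp: max_def)

section \<open>Uniform signed trees\<close>

lemma nleaves_ge_1: "nleaves t \<ge> 1"
  by (induction t) auto

definition shapes :: "nat \<Rightarrow> shape set" where
  "shapes n = {t. nleaves t = n}"

lemma shapes_1: "shapes 1 = {Lf}"
proof -
  have "t = Lf" if "nleaves t = 1" for t
    using that nleaves_ge_1 by (cases t) (auto, metis One_nat_def add_le_mono le_add1 not_less_eq_eq plus_1_eq_Suc)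
  then show ?thesis by (auto simp: shapes_def)
qed

lemma shapes_split:
  assumes "n \<ge> 2"
  shows "shapes n = (\<lambda>(k, l, r). Nd l r) ` (SIGMA k:{1..<n}. shapes k \<times> shapes (n - k))"
proof -
  have "t \<in> (\<lambda>(k, l, r). Nd l r) ` (SIGMA k:{1..<n}. shapes k \<times> shapes (n - k))" if "nleaves t = n" for t
  proof (cases t)
    case Lf
    then show ?thesis using that assms by simp
  next
    case (Nd l r)
    then have "(nleaves l, l, r) \<in> (SIGMA k:{1..<n}. shapes k \<times> shapes (n - k))"
      using that nleaves_ge_1[of l] nleaves_ge_1[of r] by (auto simp: shapes_def)
    then show ?thesis using Nd by force
  qed
  then show ?thesis by (auto simp: shapes_def)
qed

lemma inj_on_split:
  "inj_on (\<lambda>(k, l, r). Nd l r) (SIGMA k:{1..<n}. shapes k \<times> shapes (n - k))"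
  by (auto simp: inj_on_def shapes_def)

lemma finite_shapes: "finite (shapes n)"
proof (induction n rule: less_induct)
  case (less n)
  show ?case
  proof (cases "n \<ge> 2")
    case True
    then show ?thesis unfolding shapes_split[OF True] using less by (intro finite_imageI finite_SigmaI) auto
  next
    case False
    then consider "n = 0" | "n = 1" by linarith
    then show ?thesis
    proof cases
      case 1
      have "nleaves t \<noteq> 0" for t using nleaves_ge_1[of t] by linarith
      then have "shapes n = {}" unfolding shapes_def 1 by blast
      then show ?thesis by simp
    next
      case 2
      then show ?thesis using shapes_1 by simp
    qed
  qed
qed

lemma sum_shapes_split:
  fixes F :: "shape \<Rightarrow> real"
  assumes "n \<ge> 2"
  shows "sum F (shapes n) = (\<Sum>k=1..<n. \<Sum>l\<in>shapes k. \<Sum>r\<in>shapes (n - k). F (Nd l r))"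
proof -
  have "sum F (shapes n) = (\<Sum>(k, l, r)\<in>(SIGMA k:{1..<n}. shapes k \<times> shapes (n - k)). F (Nd l r))"
    unfolding shapes_split[OF assms] by (subst sum.reindex[OF inj_on_split]) (simp add: case_prod_unfold)
  also have "\<dots> = (\<Sum>k=1..<n. \<Sum>(l, r)\<in>shapes k \<times> shapes (n - k). F (Nd l r))"
    by (subst sum.Sigma) (auto simp: finite_shapes case_prod_unfold)
  finally show ?thesis by (simp add: sum.cartesian_product)
qed

lemma card_shapes: "n \<ge> 1 \<Longrightarrow> real (card (shapes n)) = 4 ^ n * nu n / 2"
proof (induction n rule: less_induct)
  case (less n)
  show ?case
  proof (cases "n = 1")
    case True
    then show ?thesis using shapes_1 by simp
  next
    case False
    then have n: "n \<ge> 2" using less.prems by simp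
    have "real (card (shapes n)) = (\<Sum>k=1..<n. real (card (shapes k)) * real (card (shapes (n - k))))"
      using sum_shapes_split[OF n, of "\<lambda>_. 1"] by simp
    also have "\<dots> = (\<Sum>k=1..<n. 4 ^ n / 4 * (nu k * nu (n - k)))"
    proof (intro sum.cong refl)
      fix k assume k: "k \<in> {1..<n}"
      then have "(4::real) ^ n = 4 ^ k * 4 ^ (n - k)" by (simp flip: power_add)
      moreover have "real (card (shapes k)) = 4 ^ k * nu k / 2"
        "real (card (shapes (n - k))) = 4 ^ (n - k) * nu (n - k) / 2"
        using k by (intro less.IH; auto)+
      ultimately show "real (card (shapes k)) * real (card (shapes (n - k))) = 4 ^ n / 4 * (nu k * nu (n - k))"
        by (simp only:) simp
    qed
    also have "\<dots> = 4 ^ n / 4 * (2 * nu n)"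
      unfolding sum_distrib_left[symmetric] nu_convolution[OF n] ..
    finally show ?thesis by simp
  qed
qed

lemma shapes_nonempty: "n \<ge> 1 \<Longrightarrow> shapes n \<noteq> {}"
  using card_shapes[of n] nu_pos[of n] by auto

lemma finite_decorate: "finite (set_pmf (decorate p t))"
  by (induction t) auto

lemma finite_T:
  assumes "n \<ge> 1"
  shows "finite (set_pmf (T p n))"
proof -
  have "set_pmf (pmf_of_set (shapes n)) = shapes n"
    by (rule set_pmf_of_set[OF shapes_nonempty[OF assms] finite_shapes])
  then show ?thesis
    unfolding T_def shapes_def[symmetric] using finite_shapes finite_decorate by simp
qed

lemma expectation_bind_finite:
  fixes h :: "'b \<Rightarrow> real"
  assumes "finite (set_pmf M)" "\<And>x. x \<in> set_pmf M \<Longrightarrow> finite (set_pmf (f x))"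
  shows "measure_pmf.expectation (bind_pmf M f) h = measure_pmf.expectation M (\<lambda>x. measure_pmf.expectation (f x) h)"
  using assms
  by (subst pmf_expectation_bind[of "set_pmf M"], simp_all)
     (subst integral_measure_pmf_real[of "set_pmf M"], auto simp: mult.commute)

lemma expectation_decorate_Nd:
  fixes h :: "stree \<Rightarrow> real"
  assumes "0 < p" "p < 1"
  shows "measure_pmf.expectation (decorate p (Nd l r)) h =
    p * measure_pmf.expectation (decorate p l) (\<lambda>a. measure_pmf.expectation (decorate p r) (\<lambda>b. h (SNode True a b)))
    + (1 - p) * measure_pmf.expectation (decorate p l) (\<lambda>a. measure_pmf.expectation (decorate p r) (\<lambda>b. h (SNode False a b)))"
  using assms by (simp add: expectation_bind_finite finite_decorate)

lemma expectation_T: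
  fixes h :: "stree \<Rightarrow> real"
  assumes "n \<ge> 1"
  shows "real (card (shapes n)) * measure_pmf.expectation (T p n) h
    = (\<Sum>t\<in>shapes n. measure_pmf.expectation (decorate p t) h)"
  unfolding T_def shapes_def[symmetric]
  using shapes_nonempty[OF assms] finite_shapes[of n]
  by (subst pmf_expectation_bind_pmf_of_set) (auto simp: finite_decorate simp flip: sum_distrib_left)

text \<open>Given the sizes of the root subtrees, these are independent uniform signed trees,
  independent of the root sign. By \<open>card_shapes\<close> the powers of 4 in the counts cancel
  and the weights \<open>nu\<close> remain.\<close>

lemma expectation_T_recursion:
  fixes h :: "stree \<Rightarrow> real"
  assumes p: "0 < p" "p < 1" and n: "n \<ge> 2"
  shows "2 * nu n * measure_pmf.expectation (T p n) h = (\<Sum>k=1..<n. nu k * nu (n - k) *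
    (p * measure_pmf.expectation (T p k) (\<lambda>a. measure_pmf.expectation (T p (n - k)) (\<lambda>b. h (SNode True a b)))
    + (1 - p) * measure_pmf.expectation (T p k) (\<lambda>a. measure_pmf.expectation (T p (n - k)) (\<lambda>b. h (SNode False a b)))))"
proof -
  let ?c = "\<lambda>n. real (card (shapes n))"
  let ?E = "\<lambda>t. measure_pmf.expectation (decorate p t)"
  let ?T = "\<lambda>n. measure_pmf.expectation (T p n)"
  have pair: "(\<Sum>l\<in>shapes k. \<Sum>r\<in>shapes m. ?E l (\<lambda>a. ?E r (\<lambda>b. f a b)))
      = ?c k * ?c m * ?T k (\<lambda>a. ?T m (\<lambda>b. f a b))"
    if "k \<ge> 1" "m \<ge> 1" for k m and f :: "stree \<Rightarrow> stree \<Rightarrow> real"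
  proof -
    have "(\<Sum>r\<in>shapes m. ?E l (\<lambda>a. ?E r (\<lambda>b. f a b))) = ?c m * ?E l (\<lambda>a. ?T m (\<lambda>b. f a b))" for l
    proof -
      have "(\<Sum>r\<in>shapes m. ?E l (\<lambda>a. ?E r (\<lambda>b. f a b))) = ?E l (\<lambda>a. \<Sum>r\<in>shapes m. ?E r (\<lambda>b. f a b))"
        by (rule Bochner_Integration.integral_sum[symmetric])
           (auto intro: integrable_measure_pmf_finite finite_decorate)
      also have "\<dots> = ?E l (\<lambda>a. ?c m * ?T m (\<lambda>b. f a b))"
        by (simp add: expectation_T[OF that(2)])
      finally show ?thesis by simp
    qed
    then have "(\<Sum>l\<in>shapes k. \<Sum>r\<in>shapes m. ?E l (\<lambda>a. ?E r (\<lambda>b. f a b)))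
        = ?c m * (\<Sum>l\<in>shapes k. ?E l (\<lambda>a. ?T m (\<lambda>b. f a b)))"
      by (simp add: sum_distrib_left)
    also have "\<dots> = ?c k * ?c m * ?T k (\<lambda>a. ?T m (\<lambda>b. f a b))"
      by (simp flip: expectation_T[OF that(1)])
    finally show ?thesis .
  qed
  let ?R = "\<lambda>k. p * ?T k (\<lambda>a. ?T (n - k) (\<lambda>b. h (SNode True a b)))
    + (1 - p) * ?T k (\<lambda>a. ?T (n - k) (\<lambda>b. h (SNode False a b)))"
  have "4 ^ n / 4 * (2 * nu n * ?T n h) = ?c n * ?T n h"
    using n by (simp add: card_shapes)
  also have "\<dots> = (\<Sum>k=1..<n. \<Sum>l\<in>shapes k. \<Sum>r\<in>shapes (n - k). ?E (Nd l r) h)"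
    using n by (simp only: expectation_T sum_shapes_split)
  also have "\<dots> = (\<Sum>k=1..<n. 4 ^ n / 4 * (nu k * nu (n - k) * ?R k))"
  proof (intro sum.cong refl)
    fix k assume k: "k \<in> {1..<n}"
    then have pow: "(4::real) ^ n = 4 ^ k * 4 ^ (n - k)" by (simp flip: power_add)
    have "(\<Sum>l\<in>shapes k. \<Sum>r\<in>shapes (n - k). ?E (Nd l r) h)
      = p * (\<Sum>l\<in>shapes k. \<Sum>r\<in>shapes (n - k). ?E l (\<lambda>a. ?E r (\<lambda>b. h (SNode True a b))))
      + (1 - p) * (\<Sum>l\<in>shapes k. \<Sum>r\<in>shapes (n - k). ?E l (\<lambda>a. ?E r (\<lambda>b. h (SNode False a b))))"
      by (simp only: expectation_decorate_Nd[OF p] sum.distrib sum_distrib_left)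
    also have "\<dots> = ?c k * ?c (n - k) * ?R k"
      using k by (subst (1 2) pair) (auto simp: algebra_simps)
    also have "?c k * ?c (n - k) = 4 ^ n / 4 * (nu k * nu (n - k))"
    proof -
      have "?c k = 4 ^ k * nu k / 2" "?c (n - k) = 4 ^ (n - k) * nu (n - k) / 2"
        using k by (intro card_shapes; auto)+
      then show ?thesis by (simp only: pow) simp
    qed
    finally show "(\<Sum>l\<in>shapes k. \<Sum>r\<in>shapes (n - k). ?E (Nd l r) h) = 4 ^ n / 4 * (nu k * nu (n - k) * ?R k)"
      by (simp only: mult.assoc)
  qed
  also have "\<dots> = 4 ^ n / 4 * (\<Sum>k=1..<n. nu k * nu (n - k) * ?R k)"
    by (simp only: sum_distrib_left)
  finally show ?thesis by simp
qed

lemma integrable_T: "n \<ge> 1 \<Longrightarrow> integrable (measure_pmf (T p n)) (f :: stree \<Rightarrow> real)"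
  by (intro integrable_measure_pmf_finite finite_T)

lemma T_one: "T p 1 = return_pmf SLeaf"
proof -
  have "{t. nleaves t = 1} = {Lf}" using shapes_1 by (simp only: shapes_def)
  then show ?thesis by (simp add: T_def pmf_of_set_singleton bind_return_pmf)
qed

definition lis_tail :: "real \<Rightarrow> nat \<Rightarrow> nat \<Rightarrow> real" where
  "lis_tail p n x = measure_pmf.prob (T p n) {t. x < LIS t}"

lemma lis_tail_expectation:
  "lis_tail p n x = measure_pmf.expectation (T p n) (\<lambda>t. of_bool (x < LIS t))"
proof -
  have "(\<lambda>t. of_bool (x < LIS t)) = (indicator {t. x < LIS t} :: stree \<Rightarrow> real)"
    by (auto simp: indicator_def)
  then show ?thesis by (simp add: lis_tail_def)
qed

lemma expectation_product:
  fixes f g :: "stree \<Rightarrow> real"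
  shows "measure_pmf.expectation M (\<lambda>a. measure_pmf.expectation N (\<lambda>b. f a * g b))
    = measure_pmf.expectation M f * measure_pmf.expectation N g"
  by simp

text \<open>The case of deterministic variables; since \<open>sum_tail\<close> is bilinear in the
  two tails, taking expectations extends it to independent ones.\<close>

lemma of_bool_sum_tail:
  assumes "x \<ge> 1" "A \<ge> 1" "B \<ge> 1"
  shows "(of_bool (x < A + B) :: real) = sum_tail (\<lambda>i. of_bool (i < A)) (\<lambda>i. of_bool (i < B)) x"
proof -
  have "(\<Sum>i=1..<x. (of_bool (i - 1 < A) - of_bool (i < A)) * of_bool (x - i < B))
    = (\<Sum>i=1..<x. if i = A then of_bool (x < A + B) else (0::real))"
    by (intro sum.cong refl) (auto simp: of_bool_def)
  also have "\<dots> = (if A \<in> {1..<x} then of_bool (x < A + B) else 0)"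
    by (simp add: sum.delta')
  finally show ?thesis
    unfolding sum_tail_by_parts[OF assms(1)] using assms by (auto simp: of_bool_def)
qed

lemma lis_tail_recursion:
  assumes p: "0 < p" "p < 1" and n: "n \<ge> 2" and x: "x \<ge> 1"
  shows "2 * nu n * lis_tail p n x
    = (\<Sum>k=1..<n. nu k * nu (n - k) * node_tail p (lis_tail p k) (lis_tail p (n - k)) x)"
proof -
  let ?T = "\<lambda>n. measure_pmf.expectation (T p n)"
  define I :: "nat \<Rightarrow> stree \<Rightarrow> real" where "I i t = of_bool (i < LIS t)" for i t
  have q: "lis_tail p n i = ?T n (I i)" for n i
    unfolding lis_tail_expectation I_def ..
  have "2 * nu n * lis_tail p n x = (\<Sum>k=1..<n. nu k * nu (n - k) *
      (p * ?T k (\<lambda>a. ?T (n - k) (\<lambda>b. I x (SNode True a b)))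
      + (1 - p) * ?T k (\<lambda>a. ?T (n - k) (\<lambda>b. I x (SNode False a b)))))"
    unfolding q by (rule expectation_T_recursion[OF p n])
  also have "\<dots> = (\<Sum>k=1..<n. nu k * nu (n - k) * node_tail p (lis_tail p k) (lis_tail p (n - k)) x)"
  proof (intro sum.cong refl arg_cong2[where f = "(*)"])
    fix k assume k: "k \<in> {1..<n}"
    have 1: "1 \<le> k" "1 \<le> n - k" using k by auto
    have prod: "?T k (\<lambda>a. ?T (n - k) (\<lambda>b. I i a * I j b)) = lis_tail p k i * lis_tail p (n - k) j" for i j
      unfolding q by (rule expectation_product)
    have "?T k (\<lambda>a. ?T (n - k) (\<lambda>b. I x (SNode True a b)))
      = ?T k (\<lambda>a. ?T (n - k) (\<lambda>b. (\<Sum>i<x. I i a * I (x - 1 - i) b) - (\<Sum>i=1..<x. I i a * I (x - i) b)))"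
      unfolding I_def LIS_SNode_True of_bool_sum_tail[OF x LIS_ge_1 LIS_ge_1] sum_tail_def ..
    also have "\<dots> = (\<Sum>i<x. ?T k (\<lambda>a. ?T (n - k) (\<lambda>b. I i a * I (x - 1 - i) b)))
        - (\<Sum>i=1..<x. ?T k (\<lambda>a. ?T (n - k) (\<lambda>b. I i a * I (x - i) b)))"
      by (simp only: Bochner_Integration.integral_diff Bochner_Integration.integral_sum
        integrable_T[OF 1(1)] integrable_T[OF 1(2)])
    also have "\<dots> = sum_tail (lis_tail p k) (lis_tail p (n - k)) x"
      unfolding prod sum_tail_def ..
    finally have plus: "?T k (\<lambda>a. ?T (n - k) (\<lambda>b. I x (SNode True a b)))
      = sum_tail (lis_tail p k) (lis_tail p (n - k)) x" .
    have I_max: "I x (SNode False a b) = I x a + I x b - I x a * I x b" for a b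
      by (auto simp: I_def LIS_SNode_False)
    have "?T k (\<lambda>a. ?T (n - k) (\<lambda>b. I x (SNode False a b)))
      = ?T k (\<lambda>a. ?T (n - k) (\<lambda>b. I x a)) + ?T k (\<lambda>a. ?T (n - k) (\<lambda>b. I x b))
        - ?T k (\<lambda>a. ?T (n - k) (\<lambda>b. I x a * I x b))"
      unfolding I_max
      by (simp only: Bochner_Integration.integral_diff Bochner_Integration.integral_add
        integrable_T[OF 1(1)] integrable_T[OF 1(2)])
    also have "\<dots> = lis_tail p k x + lis_tail p (n - k) x - lis_tail p k x * lis_tail p (n - k) x"
      unfolding prod by (simp add: q)
    finally show "p * ?T k (\<lambda>a. ?T (n - k) (\<lambda>b. I x (SNode True a b)))
      + (1 - p) * ?T k (\<lambda>a. ?T (n - k) (\<lambda>b. I x (SNode False a b)))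
      = node_tail p (lis_tail p k) (lis_tail p (n - k)) x"
      unfolding plus by (simp add: node_tail_def)
  qed
  finally show ?thesis .
qed

definition lis_mean :: "real \<Rightarrow> nat \<Rightarrow> real" where
  "lis_mean p n = measure_pmf.expectation (T p n) (\<lambda>t. real (LIS t))"

definition lis_second_moment :: "real \<Rightarrow> nat \<Rightarrow> real" where
  "lis_second_moment p n = measure_pmf.expectation (T p n) (\<lambda>t. (real (LIS t))\<^sup>2)"

lemma lis_second_moment_recursion:
  assumes p: "0 < p" "p < 1" and n: "n \<ge> 2"
  shows "2 * nu n * lis_second_moment p n \<le> (\<Sum>k=1..<n. nu k * nu (n - k) *
    (lis_second_moment p k + lis_second_moment p (n - k) + 2 * lis_mean p k * lis_mean p (n - k)))"
proof -
  let ?T = "\<lambda>n. measure_pmf.expectation (T p n)"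
  define h :: "stree \<Rightarrow> real" where "h t = (real (LIS t))\<^sup>2" for t
  define s :: "stree \<Rightarrow> stree \<Rightarrow> real" where "s a b = (real (LIS a) + real (LIS b))\<^sup>2" for a b
  \<comment> \<open>The sum also bounds the maximum at a minus. This crude bound is enough, because
    the sign probability enters the mean through the tail bound on \<open>G\<close>.\<close>
  have h_le: "h (SNode c a b) \<le> s a b" for c a b
    unfolding h_def s_def
    by (intro power_mono) (cases c; auto simp: LIS_SNode_True LIS_SNode_False)+
  have "2 * nu n * lis_second_moment p n = (\<Sum>k=1..<n. nu k * nu (n - k) *
      (p * ?T k (\<lambda>a. ?T (n - k) (\<lambda>b. h (SNode True a b)))
      + (1 - p) * ?T k (\<lambda>a. ?T (n - k) (\<lambda>b. h (SNode False a b)))))"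
    unfolding lis_second_moment_def h_def by (rule expectation_T_recursion[OF p n])
  also have "\<dots> \<le> (\<Sum>k=1..<n. nu k * nu (n - k) *
    (lis_second_moment p k + lis_second_moment p (n - k) + 2 * lis_mean p k * lis_mean p (n - k)))"
  proof (intro sum_mono mult_left_mono)
    fix k assume k: "k \<in> {1..<n}"
    have 1: "1 \<le> k" "1 \<le> n - k" using k by auto
    have le: "?T k (\<lambda>a. ?T (n - k) (\<lambda>b. h (SNode c a b))) \<le> ?T k (\<lambda>a. ?T (n - k) (\<lambda>b. s a b))" for c
      by (intro integral_mono integrable_T 1 h_le)
    have "s a b = h a + h b + 2 * (real (LIS a) * real (LIS b))" for a b
      by (simp add: s_def h_def power2_sum)
    then have "?T k (\<lambda>a. ?T (n - k) (\<lambda>b. s a b))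
      = ?T k (\<lambda>a. ?T (n - k) (\<lambda>b. h a)) + ?T k (\<lambda>a. ?T (n - k) (\<lambda>b. h b))
        + ?T k (\<lambda>a. ?T (n - k) (\<lambda>b. 2 * (real (LIS a) * real (LIS b))))"
      by (simp only: Bochner_Integration.integral_add integrable_T[OF 1(1)] integrable_T[OF 1(2)])
    also have "\<dots> = lis_second_moment p k + lis_second_moment p (n - k) + 2 * lis_mean p k * lis_mean p (n - k)"
      by (simp add: lis_second_moment_def lis_mean_def h_def)
    finally have eq: "?T k (\<lambda>a. ?T (n - k) (\<lambda>b. s a b)) = \<dots>" .
    have "p * ?T k (\<lambda>a. ?T (n - k) (\<lambda>b. h (SNode True a b)))
      + (1 - p) * ?T k (\<lambda>a. ?T (n - k) (\<lambda>b. h (SNode False a b)))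
      \<le> p * ?T k (\<lambda>a. ?T (n - k) (\<lambda>b. s a b)) + (1 - p) * ?T k (\<lambda>a. ?T (n - k) (\<lambda>b. s a b))"
      using p by (intro add_mono mult_left_mono le) auto
    also have "\<dots> = ?T k (\<lambda>a. ?T (n - k) (\<lambda>b. s a b))" by (simp add: algebra_simps)
    finally show "p * ?T k (\<lambda>a. ?T (n - k) (\<lambda>b. h (SNode True a b)))
      + (1 - p) * ?T k (\<lambda>a. ?T (n - k) (\<lambda>b. h (SNode False a b)))
      \<le> lis_second_moment p k + lis_second_moment p (n - k) + 2 * lis_mean p k * lis_mean p (n - k)"
      unfolding eq .
  qed (auto simp: nu_nonneg)
  finally show ?thesis .
qed

lemma lis_catalan_law:
  assumes p: "0 < p" "p < 1"
  shows "catalan_law p (lis_tail p) (lis_mean p) (lis_second_moment p)"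
proof
  let ?T = "\<lambda>n. measure_pmf.expectation (T p n)"
  show "0 < p" "p < 1" by fact+
  show "lis_tail p 1 x = 0" if "x \<ge> 1" for x
    unfolding lis_tail_expectation T_one using that by (simp add: LIS_SLeaf)
  show "lis_tail p n 0 = 1" for n
    unfolding lis_tail_expectation using LIS_ge_1 by (simp add: Suc_le_eq)
  show "antimono (lis_tail p n)" for n
    unfolding lis_tail_def by (intro antimonoI measure_pmf.finite_measure_mono) auto
  show "0 \<le> lis_tail p n x" for n x by (simp add: lis_tail_def)
  show "2 * nu n * lis_tail p n x
    = (\<Sum>k=1..<n. nu k * nu (n - k) * node_tail p (lis_tail p k) (lis_tail p (n - k)) x)"
    if "n \<ge> 2" "x \<ge> 1" for n x
    by (rule lis_tail_recursion[OF p that])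
  show "(real x + 1) * lis_tail p n x \<le> lis_mean p n" if "n \<ge> 1" for n x
  proof -
    have "(real x + 1) * lis_tail p n x = ?T n (\<lambda>t. (real x + 1) * of_bool (x < LIS t))"
      by (simp add: lis_tail_expectation)
    also have "\<dots> \<le> ?T n (\<lambda>t. real (LIS t))"
      by (intro integral_mono integrable_T that) auto
    finally show ?thesis by (simp add: lis_mean_def)
  qed
  show "lis_mean p n \<le> real y + lis_second_moment p n / (2 * s) + s * lis_tail p n y / 2"
    if n: "n \<ge> 1" and s: "s > 0" for n s y
  proof -
    \<comment> \<open>Above \<open>y\<close> this is the arithmetic-geometric mean inequality L <=
      L^2 / (2 s) + s / 2.\<close>
    have "real (LIS t) \<le> real y + (real (LIS t))\<^sup>2 / (2 * s) + s * of_bool (y < LIS t) / 2" for t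
    proof (cases "y < LIS t")
      case True
      have "0 \<le> (real (LIS t) - s)\<^sup>2" by simp
      then have "real (LIS t) * (2 * s) \<le> (real (LIS t))\<^sup>2 + s\<^sup>2" by (simp add: power2_diff)
      then have "real (LIS t) \<le> ((real (LIS t))\<^sup>2 + s\<^sup>2) / (2 * s)" using s by (simp add: pos_le_divide_eq)
      also have "\<dots> = (real (LIS t))\<^sup>2 / (2 * s) + s / 2"
        using s by (simp add: add_divide_distrib power2_eq_square)
      finally show ?thesis using True by simp
    next
      case False
      then have "real (LIS t) \<le> real y" by simp
      moreover have "0 \<le> (real (LIS t))\<^sup>2 / (2 * s)" using s by simp
      ultimately show ?thesis using False by simp
    qed
    then have "lis_mean p n \<le> ?T n (\<lambda>t. real y + (real (LIS t))\<^sup>2 / (2 * s) + s * of_bool (y < LIS t) / 2)"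
      unfolding lis_mean_def by (intro integral_mono integrable_T n)
    also have "\<dots> = ?T n (\<lambda>t. real y) + ?T n (\<lambda>t. (real (LIS t))\<^sup>2 / (2 * s)) + ?T n (\<lambda>t. s * of_bool (y < LIS t) / 2)"
      by (simp only: Bochner_Integration.integral_add integrable_T[OF n])
    finally show ?thesis by (simp add: lis_second_moment_def lis_tail_expectation)
  qed
  show "0 \<le> lis_mean p n" for n by (simp add: lis_mean_def)
  show "lis_second_moment p 1 \<le> 1"
    unfolding lis_second_moment_def T_one by (simp add: LIS_SLeaf)
  show "2 * nu n * lis_second_moment p n \<le> (\<Sum>k=1..<n. nu k * nu (n - k) *
    (lis_second_moment p k + lis_second_moment p (n - k) + 2 * lis_mean p k * lis_mean p (n - k)))"
    if "n \<ge> 2" for n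
    by (rule lis_second_moment_recursion[OF p that])
qed

text \<open>The free exponent \<open>s\<close> is there because \<open>lower_tail_tendsto\<close>
  asks for a positive one, whereas \<open>\<alpha> - \<epsilon>\<close> may be negative.\<close>

lemma prob_deviation_le:
  assumes n: "n \<ge> 2" and s: "\<alpha> - \<epsilon> \<le> s"
  shows "measure_pmf.prob (T p n) {t. \<bar>ln (real (LIS t)) / ln (real n) - \<alpha>\<bar> > \<epsilon>}
    \<le> lis_tail p n (nat \<lfloor>real n powr (\<alpha> + \<epsilon>)\<rfloor>) + (1 - lis_tail p n (nat \<lceil>real n powr s\<rceil>))"
proof -
  let ?U = "{t. nat \<lfloor>real n powr (\<alpha> + \<epsilon>)\<rfloor> < LIS t}"
  let ?L = "{t. nat \<lceil>real n powr s\<rceil> < LIS t}"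
  have ln: "ln (real n) > 0" using n by simp
  have "{t. \<bar>ln (real (LIS t)) / ln (real n) - \<alpha>\<bar> > \<epsilon>} \<subseteq> ?U \<union> (UNIV - ?L)"
  proof
    fix t assume "t \<in> {t. \<bar>ln (real (LIS t)) / ln (real n) - \<alpha>\<bar> > \<epsilon>}"
    then have dev: "\<alpha> + \<epsilon> < ln (real (LIS t)) / ln (real n) \<or> ln (real (LIS t)) / ln (real n) < \<alpha> - \<epsilon>" by auto
    have pos: "real (LIS t) > 0" using LIS_ge_1[of t] by simp
    have powr: "real n powr e = exp (e * ln (real n))" for e using n by (simp add: powr_def)
    from dev show "t \<in> ?U \<union> (UNIV - ?L)"
    proof
      assume "\<alpha> + \<epsilon> < ln (real (LIS t)) / ln (real n)"
      then have "(\<alpha> + \<epsilon>) * ln (real n) < ln (real (LIS t))" using ln by (simp add: pos_less_divide_eq)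
      then have "real n powr (\<alpha> + \<epsilon>) < exp (ln (real (LIS t)))" unfolding powr by simp
      then have "real n powr (\<alpha> + \<epsilon>) < real (LIS t)" using pos by simp
      then have "\<lfloor>real n powr (\<alpha> + \<epsilon>)\<rfloor> < int (LIS t)" by (simp add: floor_less_iff)
      then show ?thesis using pos by auto
    next
      assume "ln (real (LIS t)) / ln (real n) < \<alpha> - \<epsilon>"
      then have "ln (real (LIS t)) / ln (real n) < s" using s by linarith
      then have "ln (real (LIS t)) < s * ln (real n)" using ln by (simp add: pos_divide_less_eq)
      then have "exp (ln (real (LIS t))) < real n powr s" unfolding powr by simp
      then have "real (LIS t) < real n powr s" using pos by simp
      then have "LIS t \<le> nat \<lceil>real n powr s\<rceil>" by linarith
      then show ?thesis by auto
    qed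
  qed
  then have "measure_pmf.prob (T p n) {t. \<bar>ln (real (LIS t)) / ln (real n) - \<alpha>\<bar> > \<epsilon>}
      \<le> measure_pmf.prob (T p n) (?U \<union> (UNIV - ?L))"
    by (intro measure_pmf.finite_measure_mono) auto
  also have "\<dots> \<le> measure_pmf.prob (T p n) ?U + measure_pmf.prob (T p n) (UNIV - ?L)"
    by (intro measure_Un_le) auto
  also have "measure_pmf.prob (T p n) (UNIV - ?L) = 1 - measure_pmf.prob (T p n) ?L"
    using measure_pmf.prob_compl[of ?L "T p n"] by simp
  finally show ?thesis by (simp add: lis_tail_def)
qed

theorem theorem2p1:
  fixes p :: real
  assumes "0 < p" and "p < 1"
  shows "\<exists>\<alpha>::real. 1/2 < \<alpha> \<and> \<alpha> < 1 \<and>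
    (\<forall>\<epsilon>>0. (\<lambda>n. measure_pmf.prob (T p n)
        {t. \<bar>ln (real (LIS t)) / ln (real n) - \<alpha>\<bar> > \<epsilon>}) \<longlonglongrightarrow> 0) \<and>
    ereal \<alpha> = limsup (\<lambda>n. ereal (ln (measure_pmf.expectation (T p n) (\<lambda>t. real (LIS t)))
                                  / ln (real n)))"
proof -
  interpret catalan_law p "lis_tail p" "lis_mean p" "lis_second_moment p"
    by (rule lis_catalan_law[OF assms])
  define \<alpha> where "\<alpha> = 1 / (2 * \<beta>)"
  have \<alpha>: "1/2 < \<alpha>" "\<alpha> < 1" using \<beta>_bounds by (auto simp: \<alpha>_def field_simps)
  have "(\<lambda>n. measure_pmf.prob (T p n) {t. \<bar>ln (real (LIS t)) / ln (real n) - \<alpha>\<bar> > \<epsilon>}) \<longlonglongrightarrow> 0"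
    if \<epsilon>: "\<epsilon> > 0" for \<epsilon>
  proof -
    define s where "s = max (\<alpha> - \<epsilon>) (\<alpha> / 2)"
    have s: "0 < s" "s < \<alpha>" "\<alpha> - \<epsilon> \<le> s" using \<alpha> \<epsilon> by (auto simp: s_def)
    let ?B = "\<lambda>n. lis_tail p n (nat \<lfloor>real n powr (\<alpha> + \<epsilon>)\<rfloor>) + (1 - lis_tail p n (nat \<lceil>real n powr s\<rceil>))"
    have "?B \<longlonglongrightarrow> 0 + 0"
      using s \<epsilon> by (intro tendsto_add upper_tail_tendsto lower_tail_tendsto) (auto simp: \<alpha>_def)
    then have lim: "?B \<longlonglongrightarrow> 0" by simp
    have up: "\<forall>\<^sub>F n in sequentially.
        measure_pmf.prob (T p n) {t. \<bar>ln (real (LIS t)) / ln (real n) - \<alpha>\<bar> > \<epsilon>} \<le> ?B n"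
      using eventually_ge_at_top[of 2] by eventually_elim (rule prob_deviation_le[OF _ s(3)])
    show ?thesis by (rule tendsto_sandwich[OF _ up tendsto_const lim]) simp
  qed
  moreover have "(\<lambda>n. ereal (ln (lis_mean p n) / ln (real n))) \<longlonglongrightarrow> ereal \<alpha>"
    using ln_M1_tendsto by (simp add: \<alpha>_def)
  then have "ereal \<alpha> = limsup (\<lambda>n. ereal (ln (lis_mean p n) / ln (real n)))"
    by (intro lim_imp_Limsup[symmetric]) auto
  ultimately show ?thesis
    using \<alpha> unfolding lis_mean_def by blast
qed

end
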